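(* Let $K\in\{0,\ldots,N\}$, and let the norms $\|\cdot\|$ and $f_d$ on $\mathbb{R}^N$ and the dictionary $(\psi_i)_{i\in I}$ be arbitrary. Let $\tau>0$ and $\theta\ge\tau\max(\Delta_K,\Delta_{K-1})$. Then the Lebesgue measure of the set $\mathcal{D}^K(\tau)\cap\mathcal{L}_{f_d}(\theta)$ satisfies $$\overline{C}_K\,\tau^{N-K}(\theta-\hat\delta_K\tau)^K-\theta^N\varepsilon_0'(K,\tau,\theta)\ \le\ \mathbb{L}^N\left(\mathcal{D}^K(\tau)\cap\mathcal{L}_{f_d}(\theta)\right)\ \le\ \overline{C}_K\,\tau^{N-K}(\theta+\hat\delta_K\tau)^K+\theta^N\varepsilon_1(K,\tau,\theta),$$ with $$\varepsilon_0'(K,\tau,\theta)=\varepsilon_0(K,\tau,\theta)+\overline{C}_{K-1}\left(\frac{\tau}{\theta}\right)^{N-(K-1)}\left(1+\hat\delta_{K-1}\frac{\tau}{\theta}\right)^{K-1},$$ $$\varepsilon_1(K,\tau,\theta)=\varepsilon_0(K-1,\tau,\theta)-\overline{C}_{K-1}\left(\frac{\tau}{\theta}\right)^{N-(K-1)}\left(1-\hat\delta_{K-1}\frac{\tau}{\theta}\right)^{K-1}.$$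
   Context: $N\ge1$ is an integer; $\|\cdot\|$ and $f_d$ are arbitrary norms on $\mathbb{R}^N$; $\|\cdot\|_2$ is the Euclidean norm; the dictionary $(\psi_i)_{i\in I}$ is a finite family in $\mathbb{R}^N$ with $\mathrm{span}\{\psi_i:i\in I\}=\mathbb{R}^N$. For $d\in\mathbb{R}^N$ and $\tau>0$, $\mathrm{val}(\mathcal{P}_d)$ is the minimum of $\#\{i\in I:\lambda_i\neq0\}$ over all $(\lambda_i)_{i\in I}\in\mathbb{R}^I$ with $\|\sum_{i\in I}\lambda_i\psi_i-d\|\le\tau$. Set $\mathcal{D}^K(\tau)=\{d\in\mathbb{R}^N:\mathrm{val}(\mathcal{P}_d)=K\}$. For a function $f$, $\mathcal{L}_f(t)=\{w:f(w)\le t\}$. $P_V$ is the orthogonal projection onto a subspace $V$, $V^\bot$ the orthogonal complement. $\mathbb{L}^k$ is $k$-dimensional Lebesgue measure (on a $k$-dimensional subspace of $\mathbb{R}^N$, via identification with $\mathbb{R}^k$ by an orthonormal basis), with $\mathbb{L}^0(\{0\})=1$; zeroth powers equal $1$. For $J\subset I$: $\mathcal{T}_J=\mathrm{span}((\psi_j)_{j\in J})$ ($\mathrm{span}(\emptyset)=\{0\}$) and $\mathcal{T}_J^\tau=\mathcal{T}_J+P_{\mathcal{T}_J^\bot}(\mathcal{L}_{\|\cdot\|}(\tau))$. Constants. Fix $\delta_1,\delta_2>0$ with $f_d(w)\le\delta_1\|w\|_2$ and $\|w\|_2\le\delta_2\|w\|$ for all $w\in\mathbb{R}^N$, and let $\overline{\Delta}=\delta_1\delta_2$.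 For $J\subset I$, let $h_J$ be the norm on $\mathcal{T}_J^\bot$ given by $h_J(u)=\inf\{t>0:u/t\in P_{\mathcal{T}_J^\bot}(\mathcal{L}_{\|\cdot\|}(1))\}$; $\delta_J\in[0,\overline{\Delta}]$ is a fixed constant with $f_d(u)\le\delta_Jh_J(u)$ for all $u\in\mathcal{T}_J^\bot$; and, with $K=\dim\mathcal{T}_J$, $C_J=\mathbb{L}^{N-K}\big(P_{\mathcal{T}_J^\bot}(\mathcal{L}_{\|\cdot\|}(1))\big)\,\mathbb{L}^K\big(\mathcal{T}_J\cap\mathcal{L}_{f_d}(1)\big)$. $\mathcal{J}(K)$ is a fixed collection of subsets $J\subset I$ with $\dim\mathcal{T}_J=K$, such that distinct members have distinct spans $\mathcal{T}_J$ and every $K$-dimensional subspace of the form $\mathcal{T}_{J_1}$, $J_1\subset I$, equals $\mathcal{T}_J$ for some $J\in\mathcal{J}(K)$; $\mathcal{J}(0)=\{\emptyset\}$. Set $\hat\delta_K=\max_{J\in\mathcal{J}(K)}\delta_J$ and $\overline{C}_K=\sum_{J\in\mathcal{J}(K)}C_J$. Let $k_K=\max\{0,2K-N\}$ and $\mathcal{H}(K,k)=\{(J_1,J_2)\in\mathcal{J}(K)^2:\dim(\mathcal{T}_{J_1}\cap\mathcal{T}_{J_2})=k\}$ for $0\le k\le K-1$. For $(J_1,J_2)\in\mathcal{H}(K,k)$ put $W=\mathcal{T}_{J_1}\cap\mathcal{T}_{J_2}$ and $$Q_{J_1,J_2}=\mathbb{L}^{N-k}\big(W^\bot\cap\mathcal{L}_{\|\cdot\|_2}(2\delta_2)\big)\,\mathbb{L}^k\big(W\cap\mathcal{L}_{f_d}(1)\big),$$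 and let $\delta_{J_1,J_2}\in[0,3\overline{\Delta}]$ be a fixed constant such that for all $\tau,\theta>0$ with $\theta\ge\delta_{J_1,J_2}\tau$, $$\mathbb{L}^N\big(\mathcal{T}_{J_1}^\tau\cap\mathcal{T}_{J_2}^\tau\cap\mathcal{L}_{f_d}(\theta)\big)\le Q_{J_1,J_2}\tau^{N-k}(\theta+\delta_{J_1,J_2}\tau)^k.$$ For $1\le K\le N-1$ and $k_K\le k\le K-1$: $\hat\delta'_{K,k}=\max\{0,\max_{(J_1,J_2)\in\mathcal{H}(K,k)}\delta_{J_1,J_2}\}$ and $\overline{Q}_{K,k}=\sum_{(J_1,J_2)\in\mathcal{H}(K,k)}Q_{J_1,J_2}$ (both are $0$ if $\mathcal{H}(K,k)=\emptyset$). $\Delta_0=\hat\delta_0$; $\Delta_K=\max\{\Delta_{K-1},\hat\delta_K,\max_{k_K\le k\le K-1}\hat\delta'_{K,k}\}$ for $0<K<N$; $\Delta_N=\max\{\Delta_{N-1},\hat\delta_N\}$. $\varepsilon_0(K,\tau,\theta)=0$ if $K=0$ or $K=N$, and $\varepsilon_0(K,\tau,\theta)=\sum_{k=k_K}^{K-1}\overline{Q}_{K,k}\left(\frac{\tau}{\theta}\right)^{N-k}\left(1+\hat\delta'_{K,k}\frac{\tau}{\theta}\right)^k$ if $0<K<N$. Extensions to index $-1$: $\overline{C}_{-1}=0$, $\varepsilon_0(-1,\tau,\theta)=0$, $\Delta_{-1}=0$ (terms containing the factor $\overline{C}_{-1}$ are $0$). *)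

theory Defs
  imports "HOL-Analysis.Analysis"
begin

definition is_norm :: "('a::real_vector \<Rightarrow> real) \<Rightarrow> bool" where
  "is_norm f \<longleftrightarrow>
     (\<forall>x. 0 \<le> f x) \<and> (\<forall>x. f x = 0 \<longleftrightarrow> x = 0) \<and>
     (\<forall>c x. f (c *\<^sub>R x) = \<bar>c\<bar> * f x) \<and> (\<forall>x y. f (x + y) \<le> f x + f y)"

definition lev :: "('a \<Rightarrow> real) \<Rightarrow> real \<Rightarrow> 'a set" where
  "lev f t = {w. f w \<le> t}"

definition orth_proj :: "'a::euclidean_space set \<Rightarrow> 'a \<Rightarrow> 'a" where
  "orth_proj V x = (THE p. p \<in> V \<and> x - p \<in> V\<^sup>\<bottom>)"

lemma orth_proj:
  fixes V :: "'a::euclidean_space set"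
  assumes "subspace V"
  shows "orth_proj V x \<in> V \<and> x - orth_proj V x \<in> V\<^sup>\<bottom>"
proof -
  obtain y z where yz: "y \<in> span V" "\<And>w. w \<in> span V \<Longrightarrow> orthogonal z w" "x = y + z"
    using orthogonal_subspace_decomp_exists[of V x] by blast
  have V: "span V = V" using assms by (simp add: span_eq_iff)
  have ex: "y \<in> V \<and> x - y \<in> V\<^sup>\<bottom>"
    using yz V by (auto simp: orthogonal_comp_def orthogonal_commute)
  have "p = y" if "p \<in> V \<and> x - p \<in> V\<^sup>\<bottom>" for p
  proof -
    have 1: "p - y \<in> V" using that ex assms by (blast intro: subspace_diff)
    have "(x - y) - (x - p) \<in> V\<^sup>\<bottom>"
      using that ex by (blast intro: subspace_diff subspace_orthogonal_comp)
    then have "orthogonal (p - y) (p - y)" using 1 by (simp add: orthogonal_comp_def)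
    then show ?thesis by (simp add: orthogonal_def)
  qed
  then have "\<exists>!p. p \<in> V \<and> x - p \<in> V\<^sup>\<bottom>" using ex by blast
  then show ?thesis unfolding orth_proj_def by (rule theI')
qed

definition orthonormal_basis_of :: "'a::euclidean_space set \<Rightarrow> 'a set \<Rightarrow> bool" where
  "orthonormal_basis_of V B \<longleftrightarrow> finite B \<and> pairwise orthogonal B \<and> (\<forall>b\<in>B. norm b = 1) \<and> span B = V"

lemma orthonormal_basis_of_exists:
  assumes "subspace V"
  shows "\<exists>B. orthonormal_basis_of V B"
  using orthonormal_basis_subspace[OF assms] unfolding orthonormal_basis_of_def
  by (metis independent_imp_finite)

text \<open>Lebesgue measure of dimension \<open>dim V\<close> on a subspace \<open>V\<close>: the completed image of the product
  Lebesgue measure on the coordinate space \<open>B \<rightarrow>\<^sub>E \<real>\<close> of an orthonormal basis \<open>B\<close> of \<open>V\<close>. For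
  \<open>V = {0}\<close> we have \<open>B = {}\<close>, the coordinate space has one point, and the result is the unit mass
  at \<open>0\<close>. The measure does not depend on the chosen basis.\<close>

definition subspace_lebesgue :: "'a::euclidean_space set \<Rightarrow> 'a measure" where
  "subspace_lebesgue V =
     (let B = (SOME B. orthonormal_basis_of V B)
      in completion (distr (Pi\<^sub>M B (\<lambda>_. lborel)) (restrict_space borel V) (\<lambda>c. \<Sum>b\<in>B. c b *\<^sub>R b)))"

definition val :: "('a::real_vector \<Rightarrow> real) \<Rightarrow> 'i set \<Rightarrow> ('i \<Rightarrow> 'a) \<Rightarrow> real \<Rightarrow> 'a \<Rightarrow> nat" where
  "val nrm I \<psi> \<tau> d =
     (LEAST n. \<exists>c :: 'i \<Rightarrow> real. nrm ((\<Sum>i\<in>I. c i *\<^sub>R \<psi> i) - d) \<le> \<tau> \<and> n = card {i\<in>I. c i \<noteq> 0})"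

definition DK :: "('a::real_vector \<Rightarrow> real) \<Rightarrow> 'i set \<Rightarrow> ('i \<Rightarrow> 'a) \<Rightarrow> nat \<Rightarrow> real \<Rightarrow> 'a set" where
  "DK nrm I \<psi> K \<tau> = {d. val nrm I \<psi> \<tau> d = K}"

definition TJ :: "('i \<Rightarrow> 'a::real_vector) \<Rightarrow> 'i set \<Rightarrow> 'a set" where
  "TJ \<psi> J = span (\<psi> ` J)"

definition TJtau ::
  "('a::euclidean_space \<Rightarrow> real) \<Rightarrow> ('i \<Rightarrow> 'a) \<Rightarrow> 'i set \<Rightarrow> real \<Rightarrow> 'a set" where
  "TJtau nrm \<psi> J \<tau> = {x + y | x y. x \<in> TJ \<psi> J \<and> y \<in> orth_proj ((TJ \<psi> J)\<^sup>\<bottom>) ` lev nrm \<tau>}"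

definition hJ :: "('a::euclidean_space \<Rightarrow> real) \<Rightarrow> ('i \<Rightarrow> 'a) \<Rightarrow> 'i set \<Rightarrow> 'a \<Rightarrow> real" where
  "hJ nrm \<psi> J u = Inf {t. 0 < t \<and> u /\<^sub>R t \<in> orth_proj ((TJ \<psi> J)\<^sup>\<bottom>) ` lev nrm 1}"

definition CJ ::
  "('a::euclidean_space \<Rightarrow> real) \<Rightarrow> ('a \<Rightarrow> real) \<Rightarrow> ('i \<Rightarrow> 'a) \<Rightarrow> 'i set \<Rightarrow> real" where
  "CJ nrm fd \<psi> J =
     measure (subspace_lebesgue ((TJ \<psi> J)\<^sup>\<bottom>)) (orth_proj ((TJ \<psi> J)\<^sup>\<bottom>) ` lev nrm 1) *
     measure (subspace_lebesgue (TJ \<psi> J)) (TJ \<psi> J \<inter> lev fd 1)"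

definition span_representatives :: "'i set \<Rightarrow> ('i \<Rightarrow> 'a::euclidean_space) \<Rightarrow> nat \<Rightarrow> 'i set set \<Rightarrow> bool" where
  "span_representatives I \<psi> K \<J> \<longleftrightarrow>
     (\<forall>J\<in>\<J>. J \<subseteq> I \<and> dim (TJ \<psi> J) = K) \<and>
     inj_on (TJ \<psi>) \<J> \<and>
     (\<forall>J1. J1 \<subseteq> I \<and> dim (TJ \<psi> J1) = K \<longrightarrow> (\<exists>J\<in>\<J>. TJ \<psi> J = TJ \<psi> J1))"

text \<open>In the definitions below \<open>\<J> K\<close> is the chosen collection of representatives in dimension \<open>K\<close>,
  and \<open>\<delta>J J\<close> and \<open>\<delta>JJ J1 J2\<close> are the chosen constants attached to \<open>J\<close> and to the pair \<open>(J1, J2)\<close>.\<close>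

definition delta_hat :: "(nat \<Rightarrow> 'i set set) \<Rightarrow> ('i set \<Rightarrow> real) \<Rightarrow> nat \<Rightarrow> real" where
  "delta_hat \<J> \<delta>J K = Max (\<delta>J ` \<J> K)"

definition C_bar ::
  "('a::euclidean_space \<Rightarrow> real) \<Rightarrow> ('a \<Rightarrow> real) \<Rightarrow> ('i \<Rightarrow> 'a) \<Rightarrow> (nat \<Rightarrow> 'i set set) \<Rightarrow> nat \<Rightarrow> real" where
  "C_bar nrm fd \<psi> \<J> K = (\<Sum>J\<in>\<J> K. CJ nrm fd \<psi> J)"

definition HKk ::
  "('i \<Rightarrow> 'a::euclidean_space) \<Rightarrow> (nat \<Rightarrow> 'i set set) \<Rightarrow> nat \<Rightarrow> nat \<Rightarrow> ('i set \<times> 'i set) set" where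
  "HKk \<psi> \<J> K k = {(J1, J2). J1 \<in> \<J> K \<and> J2 \<in> \<J> K \<and> dim (TJ \<psi> J1 \<inter> TJ \<psi> J2) = k}"

definition QJJ ::
  "('a::euclidean_space \<Rightarrow> real) \<Rightarrow> real \<Rightarrow> ('i \<Rightarrow> 'a) \<Rightarrow> 'i set \<Rightarrow> 'i set \<Rightarrow> real" where
  "QJJ fd \<delta>\<^sub>2 \<psi> J1 J2 =
     (let W = TJ \<psi> J1 \<inter> TJ \<psi> J2
      in measure (subspace_lebesgue (W\<^sup>\<bottom>)) (W\<^sup>\<bottom> \<inter> lev norm (2 * \<delta>\<^sub>2)) *
         measure (subspace_lebesgue W) (W \<inter> lev fd 1))"

definition delta_hat' ::
  "('i \<Rightarrow> 'a::euclidean_space) \<Rightarrow> (nat \<Rightarrow> 'i set set) \<Rightarrow> ('i set \<Rightarrow> 'i set \<Rightarrow> real) \<Rightarrow> nat \<Rightarrow> nat \<Rightarrow> real" where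
  "delta_hat' \<psi> \<J> \<delta>JJ K k = Max (insert 0 ((\<lambda>(J1, J2). \<delta>JJ J1 J2) ` HKk \<psi> \<J> K k))"

definition Q_bar ::
  "('a::euclidean_space \<Rightarrow> real) \<Rightarrow> real \<Rightarrow> ('i \<Rightarrow> 'a) \<Rightarrow> (nat \<Rightarrow> 'i set set) \<Rightarrow> nat \<Rightarrow> nat \<Rightarrow> real" where
  "Q_bar fd \<delta>\<^sub>2 \<psi> \<J> K k = (\<Sum>(J1, J2)\<in>HKk \<psi> \<J> K k. QJJ fd \<delta>\<^sub>2 \<psi> J1 J2)"

text \<open>The truncated subtraction \<open>2 * K - DIM('a)\<close> on \<open>nat\<close> is \<open>max {0, 2 K - N}\<close>.\<close>

fun Delta ::
  "('i \<Rightarrow> 'a::euclidean_space) \<Rightarrow> (nat \<Rightarrow> 'i set set) \<Rightarrow> ('i set \<Rightarrow> real) \<Rightarrow>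
   ('i set \<Rightarrow> 'i set \<Rightarrow> real) \<Rightarrow> nat \<Rightarrow> real" where
  "Delta \<psi> \<J> \<delta>J \<delta>JJ 0 = delta_hat \<J> \<delta>J 0"
| "Delta \<psi> \<J> \<delta>J \<delta>JJ (Suc K) =
     (if Suc K < DIM('a)
      then Max ({Delta \<psi> \<J> \<delta>J \<delta>JJ K, delta_hat \<J> \<delta>J (Suc K)} \<union>
                delta_hat' \<psi> \<J> \<delta>JJ (Suc K) ` {2 * Suc K - DIM('a)..K})
      else max (Delta \<psi> \<J> \<delta>J \<delta>JJ K) (delta_hat \<J> \<delta>J (Suc K)))"

definition eps0 ::
  "('a::euclidean_space \<Rightarrow> real) \<Rightarrow> real \<Rightarrow> ('i \<Rightarrow> 'a) \<Rightarrow> (nat \<Rightarrow> 'i set set) \<Rightarrow>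
   ('i set \<Rightarrow> 'i set \<Rightarrow> real) \<Rightarrow> nat \<Rightarrow> real \<Rightarrow> real \<Rightarrow> real" where
  "eps0 fd \<delta>\<^sub>2 \<psi> \<J> \<delta>JJ K \<tau> \<theta> =
     (if 0 < K \<and> K < DIM('a)
      then \<Sum>k = 2 * K - DIM('a)..K - 1.
             Q_bar fd \<delta>\<^sub>2 \<psi> \<J> K k * (\<tau> / \<theta>) ^ (DIM('a) - k) * (1 + delta_hat' \<psi> \<J> \<delta>JJ K k * (\<tau> / \<theta>)) ^ k
      else 0)"

text \<open>In the following three definitions the case \<open>K = 0\<close> implements the conventions for index \<open>-1\<close>.\<close>

definition eps0' ::
  "('a::euclidean_space \<Rightarrow> real) \<Rightarrow> ('a \<Rightarrow> real) \<Rightarrow> real \<Rightarrow> ('i \<Rightarrow> 'a) \<Rightarrow> (nat \<Rightarrow> 'i set set) \<Rightarrow>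
   ('i set \<Rightarrow> real) \<Rightarrow> ('i set \<Rightarrow> 'i set \<Rightarrow> real) \<Rightarrow> nat \<Rightarrow> real \<Rightarrow> real \<Rightarrow> real" where
  "eps0' nrm fd \<delta>\<^sub>2 \<psi> \<J> \<delta>J \<delta>JJ K \<tau> \<theta> =
     eps0 fd \<delta>\<^sub>2 \<psi> \<J> \<delta>JJ K \<tau> \<theta> +
     (if K = 0 then 0
      else C_bar nrm fd \<psi> \<J> (K - 1) * (\<tau> / \<theta>) ^ (DIM('a) - (K - 1)) *
           (1 + delta_hat \<J> \<delta>J (K - 1) * (\<tau> / \<theta>)) ^ (K - 1))"

definition eps1 ::
  "('a::euclidean_space \<Rightarrow> real) \<Rightarrow> ('a \<Rightarrow> real) \<Rightarrow> real \<Rightarrow> ('i \<Rightarrow> 'a) \<Rightarrow> (nat \<Rightarrow> 'i set set) \<Rightarrow>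
   ('i set \<Rightarrow> real) \<Rightarrow> ('i set \<Rightarrow> 'i set \<Rightarrow> real) \<Rightarrow> nat \<Rightarrow> real \<Rightarrow> real \<Rightarrow> real" where
  "eps1 nrm fd \<delta>\<^sub>2 \<psi> \<J> \<delta>J \<delta>JJ K \<tau> \<theta> =
     (if K = 0 then 0
      else eps0 fd \<delta>\<^sub>2 \<psi> \<J> \<delta>JJ (K - 1) \<tau> \<theta> -
           C_bar nrm fd \<psi> \<J> (K - 1) * (\<tau> / \<theta>) ^ (DIM('a) - (K - 1)) *
           (1 - delta_hat \<J> \<delta>J (K - 1) * (\<tau> / \<theta>)) ^ (K - 1))"

definition Delta_pred ::
  "('i \<Rightarrow> 'a::euclidean_space) \<Rightarrow> (nat \<Rightarrow> 'i set set) \<Rightarrow> ('i set \<Rightarrow> real) \<Rightarrow>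
   ('i set \<Rightarrow> 'i set \<Rightarrow> real) \<Rightarrow> nat \<Rightarrow> real" where
  "Delta_pred \<psi> \<J> \<delta>J \<delta>JJ K = (if K = 0 then 0 else Delta \<psi> \<J> \<delta>J \<delta>JJ (K - 1))"

end

(*
  The set of data with val <= K is the union of the tubes T_J^tau over J in J(K), and D^K(tau) is the
  difference of two consecutive such unions. An orthogonal decomposition R^N = T_J + T_J^bot turns each
  tube, intersected with the level set of f_d, into a set squeezed between two orthogonal products,
  because elements of the cross section have f_d-size at most delta_J * tau. The union bound gives the
  upper estimate and the first Bonferroni inequality the lower one, the pairwise overlaps being
  controlled by the constants Q.
*)
theory Submission
  imports Defs
begin

text \<open>The measures on subspaces are defined through an arbitrarily chosen orthonormal basis,
  while the theorem measures sets in the standard one. The bridge is rotation invariance of Lebesgue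
  measure, obtained from its uniqueness among translation-invariant measures: it identifies Lebesgue
  measure with the product measure in the joined bases of a subspace and its complement. Scaling
  then yields the factor \<open>\<tau> ^ (N - K)\<close> from the complement and
  \<open>r ^ K\<close> from the span, and the triangle inequality for \<open>fd\<close> turns the
  radius \<open>\<theta>\<close> into \<open>\<theta> + \<delta>J * \<tau>\<close> or
  \<open>\<theta> - \<delta>J * \<tau>\<close>. Since \<open>Delta\<close> is a maximum,
  \<open>\<theta> \<ge> \<tau> * Delta\<close> keeps every inner radius nonnegative and makes every
  overlap estimate applicable. Because a difference is measured, opposite bounds meet:
  \<open>eps0\<close> at level K and the upper bound at K - 1 form \<open>eps0'\<close>, while the
  lower bound at K - 1, including its \<open>eps0\<close>, forms \<open>eps1\<close>. Levels 0 and N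
  carry no overlap correction, as only one subspace has that dimension.\<close>

subsection \<open>Lebesgue measure on subspaces\<close>

text \<open>Fubini for the double integral of \<open>1\<^sub>B(y) 1\<^sub>A(y + x)\<close> with the symmetric set \<open>B = ball 0 1\<close> gives
  \<open>\<lambda>(B) \<mu>(A) = \<mu>(B) \<lambda>(A)\<close>.\<close>

lemma translation_invariant_eq_lborel:
  fixes \<mu> :: "'a::euclidean_space measure"
  assumes sets_\<mu>: "sets \<mu> = sets borel"
    and sf: "sigma_finite_measure \<mu>"
    and inv: "\<And>t. distr \<mu> borel ((+) t) = \<mu>"
    and ball: "emeasure \<mu> (ball 0 1) = emeasure lborel (ball (0::'a) 1)"
  shows "\<mu> = lborel"
proof (rule measure_eqI)
  show "sets \<mu> = sets lborel" using sets_\<mu> by simp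
  note [measurable_cong] = sets_\<mu>
  fix A assume "A \<in> sets \<mu>"
  then have A[measurable]: "A \<in> sets borel" using sets_\<mu> by simp
  interpret \<mu>: sigma_finite_measure \<mu> by fact
  interpret L\<mu>: pair_sigma_finite lborel \<mu> ..
  define B where "B = ball (0::'a) 1"
  have B[measurable]: "B \<in> sets borel" by (simp add: B_def)
  have space_\<mu>: "space \<mu> = UNIV" using sets_eq_imp_space_eq[OF sets_\<mu>] by simp
  have shift: "(\<integral>\<^sup>+x. f (t + x) \<partial>\<mu>) = (\<integral>\<^sup>+x. f x \<partial>\<mu>)" if [measurable]: "f \<in> borel_measurable borel"
    for f and t :: 'a
    by (subst (2) inv[of t, symmetric], subst nn_integral_distr) auto
  have shift_lborel: "(\<integral>\<^sup>+x. f (x + t) \<partial>lborel) = (\<integral>\<^sup>+x. f x \<partial>lborel)"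
    if [measurable]: "f \<in> borel_measurable borel" for f :: "'a \<Rightarrow> ennreal" and t :: 'a
    by (subst (2) lborel_distr_plus[of t, symmetric], subst nn_integral_distr)
       (auto simp: add.commute)
  \<comment> \<open>Symmetry of the ball makes this set the translate of \<open>B\<close> by
    \<open>y\<close>, so invariance of \<open>\<mu>\<close> gives a value independent of
    \<open>y\<close>.\<close>
  have balls: "emeasure \<mu> {x. y - x \<in> B} = emeasure \<mu> B" for y
  proof -
    have [measurable]: "ball y 1 \<in> sets borel" by simp
    have "emeasure \<mu> (ball y 1) = emeasure (distr \<mu> borel ((+) y)) (ball y 1)"
      by (simp add: inv)
    also have "\<dots> = emeasure \<mu> ((+) y -` ball y 1 \<inter> space \<mu>)"
      by (rule emeasure_distr) auto
    also have "(+) y -` ball y 1 \<inter> space \<mu> = B"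
      by (auto simp: B_def space_\<mu> dist_norm norm_minus_commute)
    also have "ball y 1 = {x. y - x \<in> B}" by (auto simp: B_def dist_norm norm_minus_commute)
    finally show ?thesis .
  qed
  have "emeasure lborel B * emeasure \<mu> A = (\<integral>\<^sup>+y. indicator B y * emeasure \<mu> A \<partial>lborel)"
    by (simp add: nn_integral_multc)
  also have "\<dots> = (\<integral>\<^sup>+y. (\<integral>\<^sup>+x. indicator B y * indicator A (y + x) \<partial>\<mu>) \<partial>lborel)"
    by (simp add: nn_integral_cmult shift[of "indicator A"])
  also have "\<dots> = (\<integral>\<^sup>+x. (\<integral>\<^sup>+y. indicator B y * indicator A (y + x) \<partial>lborel) \<partial>\<mu>)"
    by (rule L\<mu>.Fubini'[symmetric]) simp
  also have "\<dots> = (\<integral>\<^sup>+x. (\<integral>\<^sup>+y. indicator B (y - x) * indicator A y \<partial>lborel) \<partial>\<mu>)"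
  proof (rule nn_integral_cong)
    fix x
    show "(\<integral>\<^sup>+y. indicator B y * indicator A (y + x) \<partial>lborel) =
          (\<integral>\<^sup>+y. indicator B (y - x) * indicator A y \<partial>lborel)"
      using shift_lborel[of "\<lambda>y. indicator B (y - x) * indicator A y" x] by simp
  qed
  also have "\<dots> = (\<integral>\<^sup>+y. (\<integral>\<^sup>+x. indicator B (y - x) * indicator A y \<partial>\<mu>) \<partial>lborel)"
    by (rule L\<mu>.Fubini') simp
  also have "\<dots> = (\<integral>\<^sup>+y. emeasure \<mu> B * indicator A y \<partial>lborel)"
  proof (rule nn_integral_cong)
    fix y
    have [measurable]: "{x. y - x \<in> B} \<in> sets borel" by measurable
    have "(\<integral>\<^sup>+x. indicator B (y - x) * indicator A y \<partial>\<mu>) =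
          (\<integral>\<^sup>+x. indicator {x. y - x \<in> B} x * indicator A y \<partial>\<mu>)"
      by (intro nn_integral_cong) (auto simp: indicator_def)
    also have "\<dots> = emeasure \<mu> B * indicator A y"
      by (simp add: nn_integral_multc balls)
    finally show "(\<integral>\<^sup>+x. indicator B (y - x) * indicator A y \<partial>\<mu>) = emeasure \<mu> B * indicator A y" .
  qed
  also have "\<dots> = emeasure lborel B * emeasure lborel A"
    using ball by (simp add: nn_integral_cmult B_def)
  finally have eq: "emeasure lborel B * emeasure \<mu> A = emeasure lborel B * emeasure lborel A" .
  have "emeasure lborel B \<noteq> \<infinity>"
    using emeasure_lborel_ball_finite[of "0::'a" 1] by (simp add: B_def less_top)
  moreover have "emeasure lborel B \<noteq> 0"
  proof
    assume "emeasure lborel B = 0"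
    then have "measure lborel B = 0" by (simp add: measure_def)
    then show False using content_ball_pos[of 1 "0::'a"] by (simp add: B_def)
  qed
  ultimately show "emeasure \<mu> A = emeasure lborel A"
    using eq by (simp add: ennreal_mult_cancel_left)
qed

text \<open>The image measure satisfies the uniqueness criterion: translating it by
  \<open>f s\<close> is the same as first translating by \<open>s\<close>, because \<open>f\<close>
  is linear and onto, and balls around 0 keep their measure because \<open>f\<close> preserves
  norms.\<close>

lemma distr_lborel_orthogonal_transformation:
  fixes f :: "'a::euclidean_space \<Rightarrow> 'a"
  assumes f: "orthogonal_transformation f"
  shows "distr lborel borel f = lborel"
proof (rule translation_invariant_eq_lborel)
  have lin: "linear f" using f by (rule orthogonal_transformation_linear)
  then have [measurable]: "f \<in> borel_measurable borel"
    by (intro borel_measurable_continuous_onI linear_continuous_on linear_conv_bounded_linear[THEN iffD1])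
  have emeas: "emeasure (distr lborel borel f) (ball 0 r) = emeasure lborel (ball (0::'a) r)" for r
  proof -
    have "f -` ball 0 r = ball 0 r"
      using f by (auto simp: orthogonal_transformation_norm)
    then show ?thesis by (subst emeasure_distr) auto
  qed
  show "emeasure (distr lborel borel f) (ball 0 1) = emeasure lborel (ball (0::'a) 1)" by (rule emeas)
  show "sigma_finite_measure (distr lborel borel f)"
  proof
    show "\<exists>A. countable A \<and> A \<subseteq> sets (distr lborel borel f) \<and> \<Union>A = space (distr lborel borel f) \<and>
        (\<forall>a\<in>A. emeasure (distr lborel borel f) a \<noteq> \<infinity>)"
    proof (intro exI conjI)
      show "countable (range (\<lambda>n::nat. ball (0::'a) (real n)))" by simp
      show "\<Union>(range (\<lambda>n::nat. ball (0::'a) (real n))) = space (distr lborel borel f)"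
        using reals_Archimedean2 by auto
    qed (use emeas emeasure_lborel_ball_finite in \<open>auto simp: less_top\<close>)
  qed
  fix t :: 'a
  obtain s where t: "t = f s" using orthogonal_transformation_surj[OF f] by (metis surjD)
  have "distr (distr lborel borel f) borel ((+) t) = distr lborel borel (\<lambda>x. f (s + x))"
    by (subst distr_distr) (auto simp: o_def t linear_add[OF lin])
  also have "\<dots> = distr (distr lborel borel ((+) s)) borel f"
    by (subst distr_distr) (auto simp: o_def)
  finally show "distr (distr lborel borel f) borel ((+) t) = distr lborel borel f"
    by (simp add: lborel_distr_plus)
qed simp

section \<open>Coordinates with respect to an orthonormal basis\<close>

lemma orthonormal_basis_of_inner:
  assumes "orthonormal_basis_of V B" "a \<in> B" "b \<in> B"
  shows "a \<bullet> b = (if a = b then 1 else 0)"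
proof (cases "a = b")
  case True
  then show ?thesis using assms by (simp add: orthonormal_basis_of_def flip: norm_eq_1)
next
  case False
  then show ?thesis using assms unfolding orthonormal_basis_of_def pairwise_def orthogonal_def by auto
qed

lemma orthonormal_basis_of_independent:
  assumes "orthonormal_basis_of V B"
  shows "independent B"
proof (rule pairwise_orthogonal_independent)
  show "pairwise orthogonal B" using assms by (simp add: orthonormal_basis_of_def)
  show "0 \<notin> B" using assms unfolding orthonormal_basis_of_def by (metis norm_zero zero_neq_one)
qed

lemma orthonormal_basis_of_card:
  assumes "orthonormal_basis_of V B"
  shows "card B = dim V"
proof -
  have "card B = dim B"
    using orthonormal_basis_of_independent[OF assms] by (simp add: dim_eq_card_independent)
  also have "\<dots> = dim (span B)" by (simp only: dim_span)
  also have "span B = V" using assms by (simp add: orthonormal_basis_of_def)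
  finally show ?thesis .
qed

lemma coordinate_sum_mem:
  assumes "orthonormal_basis_of V B"
  shows "(\<Sum>b\<in>B. c b *\<^sub>R b) \<in> V"
proof -
  have "(\<Sum>b\<in>B. c b *\<^sub>R b) \<in> span B" by (intro span_sum span_scale span_base)
  then show ?thesis using assms by (simp add: orthonormal_basis_of_def)
qed

lemma measurable_coordinate_sum [measurable]:
  fixes B :: "'a::euclidean_space set"
  shows "(\<lambda>c. \<Sum>b\<in>B. c b *\<^sub>R b) \<in> Pi\<^sub>M B (\<lambda>_. lborel) \<rightarrow>\<^sub>M borel"
proof (rule borel_measurable_sum)
  fix b assume "b \<in> B"
  then have [measurable]: "(\<lambda>c. c b) \<in> Pi\<^sub>M B (\<lambda>_. lborel) \<rightarrow>\<^sub>M (borel :: real measure)"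
    using measurable_component_singleton[of b B "\<lambda>_. lborel"] by simp
  show "(\<lambda>c. c b *\<^sub>R b) \<in> borel_measurable (Pi\<^sub>M B (\<lambda>_. lborel))" by measurable
qed

interpretation lborel_product: product_sigma_finite "\<lambda>_. lborel" ..

text \<open>For the standard basis this is \<open>lborel_eq\<close>. A bijection \<open>g\<close>
  from \<open>Basis\<close> to \<open>B\<close> extends linearly to an isometry \<open>f\<close>;
  renaming coordinates along \<open>g\<close> and then applying \<open>f\<close> transports the
  known case, and \<open>f\<close> leaves \<open>lborel\<close> unchanged.\<close>

lemma lborel_eq_distr_orthonormal_basis:
  fixes B :: "'a::euclidean_space set"
  assumes B: "orthonormal_basis_of UNIV B"
  shows "distr (Pi\<^sub>M B (\<lambda>_. lborel)) borel (\<lambda>c. \<Sum>b\<in>B. c b *\<^sub>R b) = lborel"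
proof -
  have fin: "finite B" using B by (simp add: orthonormal_basis_of_def)
  have "card (Basis :: 'a set) = card B" using orthonormal_basis_of_card[OF B] by simp
  then obtain g where g: "bij_betw g (Basis :: 'a set) B"
    using fin finite_same_card_bij[OF finite_Basis] by blast
  define g' where "g' = inv_into Basis g"
  have g': "g' b \<in> Basis" "g (g' b) = b" if "b \<in> B" for b
    using g that by (auto simp: g'_def bij_betw_def f_inv_into_f inv_into_into)
  have g'g: "g' (g b) = b" if "b \<in> Basis" for b
    using g that by (simp add: g'_def bij_betw_def)
  have gB: "g b \<in> B" if "b \<in> Basis" for b
    using g that by (auto simp: bij_betw_def)
  define f where "f x = (\<Sum>b\<in>Basis. (x \<bullet> b) *\<^sub>R g b)" for x :: 'a
  have f: "orthogonal_transformation f"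
    unfolding orthogonal_transformation_def
  proof (intro conjI allI)
    show "linear f"
      by (rule linearI) (auto simp: f_def inner_add_left scaleR_add_left sum.distrib scaleR_sum_right)
    fix v w
    have gg: "g a \<bullet> g b = (if a = b then 1 else 0)" if "a \<in> Basis" "b \<in> Basis" for a b
      using orthonormal_basis_of_inner[OF B, of "g a" "g b"] that gB g'g by metis
    have "f v \<bullet> f w = (\<Sum>b\<in>Basis. \<Sum>a\<in>Basis. (v \<bullet> a) * ((w \<bullet> b) * (g a \<bullet> g b)))"
      by (simp add: f_def inner_sum_left inner_sum_right sum_distrib_left mult.left_commute)
    also have "\<dots> = (\<Sum>b\<in>Basis. \<Sum>a\<in>Basis. if a = b then (v \<bullet> a) * (w \<bullet> b) else 0)"
      by (intro sum.cong refl) (simp add: gg)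
    also have "\<dots> = v \<bullet> w"
      by (simp add: euclidean_inner[of v w])
    finally show "f v \<bullet> f w = v \<bullet> w" .
  qed
  then have [measurable]: "f \<in> borel_measurable borel"
    by (intro borel_measurable_continuous_onI linear_continuous_on
        linear_conv_bounded_linear[THEN iffD1] orthogonal_transformation_linear)
  define h where "h c = (\<lambda>b\<in>B. c (g' b))" for c :: "'a \<Rightarrow> real"
  have h[measurable]: "h \<in> Pi\<^sub>M Basis (\<lambda>_. lborel) \<rightarrow>\<^sub>M Pi\<^sub>M B (\<lambda>_. lborel)"
    unfolding h_def by (intro measurable_restrict measurable_component_singleton g')
  \<comment> \<open>Renaming coordinates permutes the sides of a box, and a finite product measure
    is determined by its values on boxes.\<close>
  have PiM_B: "distr (Pi\<^sub>M Basis (\<lambda>_. lborel)) (Pi\<^sub>M B (\<lambda>_. lborel)) h = Pi\<^sub>M B (\<lambda>_. lborel)"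
  proof (rule lborel_product.PiM_eqI)
    fix A :: "'a \<Rightarrow> real set" assume A: "\<And>i. i \<in> B \<Longrightarrow> A i \<in> sets lborel"
    have "h c \<in> Pi\<^sub>E B A \<longleftrightarrow> (\<forall>b\<in>Basis. c b \<in> A (g b))" for c
      unfolding h_def restrict_PiE_iff using g' g'g gB by metis
    then have "h -` Pi\<^sub>E B A \<inter> space (Pi\<^sub>M Basis (\<lambda>_. lborel)) = Pi\<^sub>E Basis (\<lambda>b. A (g b))"
      by (auto simp: space_PiM PiE_iff)
    then have "emeasure (distr (Pi\<^sub>M Basis (\<lambda>_. lborel)) (Pi\<^sub>M B (\<lambda>_. lborel)) h) (Pi\<^sub>E B A)
        = emeasure (Pi\<^sub>M Basis (\<lambda>_. lborel)) (Pi\<^sub>E Basis (\<lambda>b. A (g b)))"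
      using A fin by (subst emeasure_distr) (auto intro!: sets_PiM_I_finite)
    also have "\<dots> = (\<Prod>b\<in>Basis. emeasure lborel (A (g b)))"
      using A gB by (intro lborel_product.emeasure_PiM) auto
    also have "\<dots> = (\<Prod>b\<in>B. emeasure lborel (A b))"
      by (rule prod.reindex_bij_betw[OF g])
    finally show "emeasure (distr (Pi\<^sub>M Basis (\<lambda>_. lborel)) (Pi\<^sub>M B (\<lambda>_. lborel)) h) (Pi\<^sub>E B A)
        = (\<Prod>b\<in>B. emeasure lborel (A b))" .
  qed (simp_all add: fin)
  have sums: "(\<Sum>b\<in>B. h c b *\<^sub>R b) = f (\<Sum>b\<in>Basis. c b *\<^sub>R b)" for c
  proof -
    have "(\<Sum>b\<in>B. h c b *\<^sub>R b) = (\<Sum>b\<in>B. c (g' b) *\<^sub>R b)"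
      by (intro sum.cong) (auto simp: h_def)
    also have "\<dots> = (\<Sum>b\<in>Basis. c (g' (g b)) *\<^sub>R g b)"
      by (rule sum.reindex_bij_betw[OF g, symmetric])
    also have "\<dots> = f (\<Sum>b\<in>Basis. c b *\<^sub>R b)"
      by (simp add: f_def g'g)
    finally show ?thesis .
  qed
  have "distr (Pi\<^sub>M B (\<lambda>_. lborel)) borel (\<lambda>c. \<Sum>b\<in>B. c b *\<^sub>R b)
      = distr (Pi\<^sub>M Basis (\<lambda>_. lborel)) borel (\<lambda>c. f (\<Sum>b\<in>Basis. c b *\<^sub>R b))"
    by (subst PiM_B[symmetric], subst distr_distr) (auto simp: o_def sums)
  also have "\<dots> = distr (distr (Pi\<^sub>M Basis (\<lambda>_. lborel)) borel (\<lambda>c. \<Sum>b\<in>Basis. c b *\<^sub>R b)) borel f"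
    by (subst distr_distr) (auto simp: o_def)
  also have "\<dots> = lborel"
    by (simp add: lborel_eq[symmetric] distr_lborel_orthogonal_transformation[OF f])
  finally show ?thesis .
qed

text \<open>Opens the \<open>SOME\<close> in the definition once, so that later arguments work with
  one named orthonormal basis. On Borel subsets of \<open>V\<close> the completion keeps the value
  of the coordinate measure.\<close>

lemma emeasure_subspace_lebesgue:
  fixes V :: "'a::euclidean_space set"
  assumes V: "subspace V"
  obtains B where "orthonormal_basis_of V B"
    and "\<And>A. A \<in> sets borel \<Longrightarrow> A \<subseteq> V \<Longrightarrow> emeasure (subspace_lebesgue V) A =
          emeasure (Pi\<^sub>M B (\<lambda>_. lborel)) ((\<lambda>c. \<Sum>b\<in>B. c b *\<^sub>R b) -` A \<inter> space (Pi\<^sub>M B (\<lambda>_. lborel)))"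
proof
  let ?B = "SOME B. orthonormal_basis_of V B"
  show B: "orthonormal_basis_of V ?B"
    using orthonormal_basis_of_exists[OF V] by (rule someI_ex)
  let ?f = "\<lambda>c. \<Sum>b\<in>?B. c b *\<^sub>R b"
  have f: "?f \<in> Pi\<^sub>M ?B (\<lambda>_. lborel) \<rightarrow>\<^sub>M restrict_space borel V"
    by (rule measurable_restrict_space2) (auto intro: coordinate_sum_mem[OF B])
  fix A :: "'a set" assume A: "A \<in> sets borel" "A \<subseteq> V"
  then have A': "A \<in> sets (restrict_space borel V)"
    by (auto simp: sets_restrict_space)
  show "emeasure (subspace_lebesgue V) A =
          emeasure (Pi\<^sub>M ?B (\<lambda>_. lborel)) (?f -` A \<inter> space (Pi\<^sub>M ?B (\<lambda>_. lborel)))"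
    unfolding subspace_lebesgue_def Let_def using A' f
    by (simp add: emeasure_distr)
qed

text \<open>Joining orthonormal bases of \<open>V\<close> and of its complement gives one of the
  whole space, so Lebesgue measure becomes the product of the two coordinate measures. The sum set
  corresponds to a rectangle there, because the orthogonal decomposition of a vector is
  unique.\<close>

lemma emeasure_lborel_orthogonal_sum:
  fixes V :: "'a::euclidean_space set"
  assumes V: "subspace V"
    and A: "A \<in> sets borel" "A \<subseteq> V" and C: "C \<in> sets borel" "C \<subseteq> V\<^sup>\<bottom>"
    and S: "{x + y | x y. x \<in> A \<and> y \<in> C} \<in> sets borel" (is "?S \<in> _")
  shows "emeasure lborel {x + y | x y. x \<in> A \<and> y \<in> C}
       = emeasure (subspace_lebesgue V) A * emeasure (subspace_lebesgue (V\<^sup>\<bottom>)) C"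
proof -
  have V': "subspace (V\<^sup>\<bottom>)" by (rule subspace_orthogonal_comp)
  obtain B where B: "orthonormal_basis_of V B" and mB:
    "\<And>A. A \<in> sets borel \<Longrightarrow> A \<subseteq> V \<Longrightarrow> emeasure (subspace_lebesgue V) A =
          emeasure (Pi\<^sub>M B (\<lambda>_. lborel)) ((\<lambda>c. \<Sum>b\<in>B. c b *\<^sub>R b) -` A \<inter> space (Pi\<^sub>M B (\<lambda>_. lborel)))"
    using emeasure_subspace_lebesgue[OF V] by blast
  obtain B' where B': "orthonormal_basis_of (V\<^sup>\<bottom>) B'" and mB':
    "\<And>C. C \<in> sets borel \<Longrightarrow> C \<subseteq> V\<^sup>\<bottom> \<Longrightarrow> emeasure (subspace_lebesgue (V\<^sup>\<bottom>)) C =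
          emeasure (Pi\<^sub>M B' (\<lambda>_. lborel)) ((\<lambda>c. \<Sum>b\<in>B'. c b *\<^sub>R b) -` C \<inter> space (Pi\<^sub>M B' (\<lambda>_. lborel)))"
    using emeasure_subspace_lebesgue[OF V'] by blast
  have fin: "finite B" "finite B'" using B B' by (auto simp: orthonormal_basis_of_def)
  have sub: "B \<subseteq> V" "B' \<subseteq> V\<^sup>\<bottom>" using B B' by (auto simp: orthonormal_basis_of_def span_base)
  \<comment> \<open>\<open>merge\<close> splits coordinates only over disjoint index sets. A common
    basis vector would be orthogonal to itself, hence 0, which an independent set cannot
    contain.\<close>
  have disj: "B \<inter> B' = {}"
  proof -
    have "B \<inter> B' \<subseteq> {0}" using sub orthogonal_Int_0[OF V] by blast
    moreover have "0 \<notin> B" using orthonormal_basis_of_independent[OF B] dependent_zero by blast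
    ultimately show ?thesis by blast
  qed
  have ortho: "orthogonal x y" "orthogonal y x" if "x \<in> V" "y \<in> V\<^sup>\<bottom>" for x y
    using that by (auto simp: orthogonal_comp_def orthogonal_commute)
  have span: "span (B \<union> B') = UNIV"
  proof -
    have "x \<in> span (B \<union> B')" for x
    proof -
      have "x \<in> V + V\<^sup>\<bottom>" using subspace_sum_orthogonal_comp[OF V] by simp
      then obtain v w where "x = v + w" "v \<in> span B" "w \<in> span B'"
        using B B' unfolding orthonormal_basis_of_def by (metis set_plus_elim)
      then show ?thesis
        using span_mono[of B "B \<union> B'"] span_mono[of B' "B \<union> B'"] by (auto intro!: span_add)
    qed
    then show ?thesis by blast
  qed
  have BB: "orthonormal_basis_of UNIV (B \<union> B')"
    unfolding orthonormal_basis_of_def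
  proof (intro conjI)
    show "pairwise orthogonal (B \<union> B')"
      unfolding pairwise_def
    proof (intro ballI impI)
      fix x y assume "x \<in> B \<union> B'" "y \<in> B \<union> B'" "x \<noteq> y"
      then show "orthogonal x y"
        using B B' sub ortho unfolding orthonormal_basis_of_def pairwise_def by blast
    qed
  qed (use B B' fin span in \<open>auto simp: orthonormal_basis_of_def\<close>)
  let ?P = "\<lambda>B. Pi\<^sub>M B (\<lambda>_. lborel :: real measure)"
  let ?f = "\<lambda>B c. \<Sum>b\<in>B. c b *\<^sub>R b :: 'a"
  interpret B': sigma_finite_measure "?P B'" by (rule lborel_product.sigma_finite[OF fin(2)])
  have dec: "?f (B \<union> B') (merge B B' (c, d)) = ?f B c + ?f B' d" for c d
    using fin disj by (auto simp: sum.union_disjoint merge_def intro!: sum.cong arg_cong2[where f="(+)"])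
  \<comment> \<open>Uniqueness of the decomposition: the difference of two decompositions lies both
    in \<open>V\<close> and in its complement. This is what makes the preimage of the sum set a
    rectangle.\<close>
  have inS: "x + y \<in> ?S \<longleftrightarrow> x \<in> A \<and> y \<in> C" if xy: "x \<in> V" "y \<in> V\<^sup>\<bottom>" for x y
  proof
    assume "x + y \<in> ?S"
    then obtain x' y' where *: "x' \<in> A" "y' \<in> C" "x + y = x' + y'" by blast
    have eq: "y' - y = x - x'" using * by (simp add: algebra_simps)
    have "x - x' \<in> V" using * A xy V by (auto intro: subspace_diff)
    moreover have "y' - y \<in> V\<^sup>\<bottom>" using * C xy V' by (auto intro: subspace_diff)
    ultimately have "x - x' \<in> V \<inter> V\<^sup>\<bottom>" by (simp only: eq IntI)
    then have "x - x' = 0" by (simp only: orthogonal_Int_0[OF V] singleton_iff)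
    then have "x = x'" "y = y'" using *(3) by simp_all
    then show "x \<in> A \<and> y \<in> C" using * by simp
  next
    assume "x \<in> A \<and> y \<in> C"
    then show "x + y \<in> ?S" unfolding mem_Collect_eq by (intro exI conjI) auto
  qed
  have "emeasure lborel ?S = emeasure (distr (?P (B \<union> B')) borel (?f (B \<union> B'))) ?S"
    by (simp only: lborel_eq_distr_orthonormal_basis[OF BB])
  also have "\<dots> = emeasure (distr (distr (?P B \<Otimes>\<^sub>M ?P B') (?P (B \<union> B')) (merge B B')) borel (?f (B \<union> B'))) ?S"
    by (simp only: lborel_product.distr_merge[OF disj fin])
  also have "\<dots> = emeasure (distr (?P B \<Otimes>\<^sub>M ?P B') borel (\<lambda>p. ?f (B \<union> B') (merge B B' p))) ?S"
    by (subst distr_distr) (simp_all add: o_def)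
  also have "\<dots> = emeasure (?P B \<Otimes>\<^sub>M ?P B')
      ((\<lambda>p. ?f (B \<union> B') (merge B B' p)) -` ?S \<inter> space (?P B \<Otimes>\<^sub>M ?P B'))"
    by (rule emeasure_distr[OF _ S]) measurable
  also have "(\<lambda>p. ?f (B \<union> B') (merge B B' p)) -` ?S \<inter> space (?P B \<Otimes>\<^sub>M ?P B')
      = (?f B -` A \<inter> space (?P B)) \<times> (?f B' -` C \<inter> space (?P B'))"
  proof (rule set_eqI)
    fix p :: "('a \<Rightarrow> real) \<times> ('a \<Rightarrow> real)"
    obtain c d where p: "p = (c, d)" by (rule prod.exhaust)
    show "p \<in> (\<lambda>p. ?f (B \<union> B') (merge B B' p)) -` ?S \<inter> space (?P B \<Otimes>\<^sub>M ?P B')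
      \<longleftrightarrow> p \<in> (?f B -` A \<inter> space (?P B)) \<times> (?f B' -` C \<inter> space (?P B'))"
      unfolding p vimage_eq Int_iff mem_Sigma_iff space_pair_measure dec
        inS[OF coordinate_sum_mem[OF B] coordinate_sum_mem[OF B']] by blast
  qed
  also have "emeasure (?P B \<Otimes>\<^sub>M ?P B') \<dots> = emeasure (subspace_lebesgue V) A * emeasure (subspace_lebesgue (V\<^sup>\<bottom>)) C"
    unfolding mB[OF A] mB'[OF C]
    by (intro B'.emeasure_pair_measure_Times measurable_sets[OF measurable_coordinate_sum] A C)
  finally show ?thesis .
qed

text \<open>Each coordinate contributes one factor \<open>r\<close>. The identity is checked on
  boxes, which determine the product measure; an empty \<open>B\<close> gives the factor
  \<open>r ^ 0 = 1\<close>, as needed for the subspace \<open>{0}\<close>.\<close>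

lemma emeasure_PiM_lborel_scaleR:
  fixes r :: real
  assumes fin: "finite B" and r: "0 < r" and A: "A \<in> sets (Pi\<^sub>M B (\<lambda>_. lborel))"
  shows "emeasure (Pi\<^sub>M B (\<lambda>_. lborel)) A =
    ennreal (r ^ card B) * emeasure (Pi\<^sub>M B (\<lambda>_. lborel)) ((\<lambda>c. \<lambda>b\<in>B. r * c b) -` A \<inter> space (Pi\<^sub>M B (\<lambda>_. lborel)))"
proof -
  let ?P = "Pi\<^sub>M B (\<lambda>_. lborel :: real measure)"
  let ?s = "\<lambda>c. \<lambda>b\<in>B. r * c b"
  have [measurable]: "?s \<in> ?P \<rightarrow>\<^sub>M ?P"
  proof (rule measurable_restrict)
    fix b assume "b \<in> B"
    then have [measurable]: "(\<lambda>c. c b) \<in> ?P \<rightarrow>\<^sub>M (borel :: real measure)"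
      using measurable_component_singleton[of b B "\<lambda>_. lborel"] by simp
    show "(\<lambda>c. r * c b) \<in> ?P \<rightarrow>\<^sub>M lborel" by measurable
  qed
  have "scale_measure (ennreal (r ^ card B)) (distr ?P ?P ?s) = ?P"
  proof (rule lborel_product.PiM_eqI)
    fix A :: "_ \<Rightarrow> real set" assume A: "\<And>i. i \<in> B \<Longrightarrow> A i \<in> sets lborel"
    have Am: "(*) r -` A i \<in> sets borel" if "i \<in> B" for i
      using A[OF that] measurable_sets[of "(*) r" borel borel "A i"] by simp
    have "?s -` Pi\<^sub>E B A \<inter> space ?P = Pi\<^sub>E B (\<lambda>i. (*) r -` A i)"
      by (auto simp: space_PiM PiE_iff)
    then have "emeasure (scale_measure (ennreal (r ^ card B)) (distr ?P ?P ?s)) (Pi\<^sub>E B A)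
        = ennreal (r ^ card B) * emeasure ?P (Pi\<^sub>E B (\<lambda>i. (*) r -` A i))"
      using A fin by (simp, subst emeasure_distr) (auto intro!: sets_PiM_I_finite)
    also have "\<dots> = ennreal (r ^ card B) * (\<Prod>i\<in>B. emeasure lborel ((*) r -` A i))"
      using Am fin by (subst lborel_product.emeasure_PiM) auto
    also have "\<dots> = (\<Prod>i\<in>B. ennreal r * emeasure lborel ((*) r -` A i))"
      using r by (simp add: prod.distrib ennreal_power)
    also have "\<dots> = (\<Prod>i\<in>B. emeasure lborel (A i))"
    proof (rule prod.cong[OF refl])
      fix i assume i: "i \<in> B"
      have [measurable]: "A i \<in> sets borel" using A[OF i] by simp
      have "emeasure lborel (A i) = emeasure (density (distr lborel borel ((*) r)) (\<lambda>_. ennreal \<bar>r\<bar>)) (A i)"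
        using lborel_distr_mult'[of r] r by simp
      also have "\<dots> = ennreal r * emeasure (distr lborel borel ((*) r)) (A i)"
        using r by (simp add: emeasure_density nn_integral_cmult_indicator)
      also have "\<dots> = ennreal r * emeasure lborel ((*) r -` A i)"
        by (subst emeasure_distr) auto
      finally show "ennreal r * emeasure lborel ((*) r -` A i) = emeasure lborel (A i)" by simp
    qed
    finally show "emeasure (scale_measure (ennreal (r ^ card B)) (distr ?P ?P ?s)) (Pi\<^sub>E B A)
        = (\<Prod>i\<in>B. emeasure lborel (A i))" .
  qed (use fin in simp_all)
  then have "emeasure ?P A = emeasure (scale_measure (ennreal (r ^ card B)) (distr ?P ?P ?s)) A"
    by simp
  also have "\<dots> = ennreal (r ^ card B) * emeasure ?P (?s -` A \<inter> space ?P)"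
    using A by (simp, subst emeasure_distr) auto
  finally show ?thesis .
qed

text \<open>Scaling a vector scales its coordinates. This homogeneity is the origin of the powers of
  \<open>\<tau>\<close> and of the radius in all tube estimates.\<close>

lemma emeasure_subspace_lebesgue_scaleR:
  fixes V :: "'a::euclidean_space set"
  assumes V: "subspace V" and r: "0 < r" and A: "A \<in> sets borel" "A \<subseteq> V"
    and rA: "(*\<^sub>R) r ` A \<in> sets borel"
  shows "emeasure (subspace_lebesgue V) ((*\<^sub>R) r ` A) = ennreal (r ^ dim V) * emeasure (subspace_lebesgue V) A"
proof -
  obtain B where B: "orthonormal_basis_of V B" and mB:
    "\<And>A. A \<in> sets borel \<Longrightarrow> A \<subseteq> V \<Longrightarrow> emeasure (subspace_lebesgue V) A =
          emeasure (Pi\<^sub>M B (\<lambda>_. lborel)) ((\<lambda>c. \<Sum>b\<in>B. c b *\<^sub>R b) -` A \<inter> space (Pi\<^sub>M B (\<lambda>_. lborel)))"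
    using emeasure_subspace_lebesgue[OF V] by blast
  have fin: "finite B" using B by (simp add: orthonormal_basis_of_def)
  let ?P = "Pi\<^sub>M B (\<lambda>_. lborel :: real measure)"
  let ?f = "\<lambda>c. \<Sum>b\<in>B. c b *\<^sub>R b :: 'a"
  have sub: "(*\<^sub>R) r ` A \<subseteq> V" using A V by (auto intro: subspace_scale)
  have f_scale: "?f (\<lambda>b\<in>B. r * c b) = r *\<^sub>R ?f c" for c
    by (simp add: scaleR_sum_right)
  have "emeasure (subspace_lebesgue V) ((*\<^sub>R) r ` A) = emeasure ?P (?f -` ((*\<^sub>R) r ` A) \<inter> space ?P)"
    by (rule mB[OF rA sub])
  also have "\<dots> = ennreal (r ^ card B) *
      emeasure ?P ((\<lambda>c. \<lambda>b\<in>B. r * c b) -` (?f -` ((*\<^sub>R) r ` A) \<inter> space ?P) \<inter> space ?P)"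
    by (rule emeasure_PiM_lborel_scaleR[OF fin r measurable_sets[OF measurable_coordinate_sum rA]])
  also have "(\<lambda>c. \<lambda>b\<in>B. r * c b) -` (?f -` ((*\<^sub>R) r ` A) \<inter> space ?P) \<inter> space ?P = ?f -` A \<inter> space ?P"
    using r by (auto simp: f_scale space_PiM simp del: restrict_apply)
  finally show ?thesis by (simp add: mB A orthonormal_basis_of_card[OF B])
qed

subsection \<open>Norms and orthogonal projections\<close>

lemma
  assumes "is_norm f"
  shows is_norm_nonneg: "0 \<le> f x"
    and is_norm_eq_0_iff: "f x = 0 \<longleftrightarrow> x = 0"
    and is_norm_scaleR: "f (c *\<^sub>R x) = \<bar>c\<bar> * f x"
    and is_norm_triangle: "f (x + y) \<le> f x + f y"
  using assms by (auto simp: is_norm_def)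

lemma is_norm_minus:
  assumes "is_norm f"
  shows "f (- x) = f x"
  using is_norm_scaleR[OF assms, of "-1" x] by simp

lemma is_norm_minus_commute:
  assumes "is_norm f"
  shows "f (x - y) = f (y - x)"
  using is_norm_minus[OF assms, of "x - y"] by simp

lemma is_norm_sum_le:
  assumes "is_norm f"
  shows "f (\<Sum>b\<in>B. g b) \<le> (\<Sum>b\<in>B. f (g b))"
proof (induction B rule: infinite_finite_induct)
  case (insert b B)
  then show ?case using is_norm_triangle[OF assms, of "g b" "\<Sum>b\<in>B. g b"] by simp
qed (use is_norm_eq_0_iff[OF assms, of 0] in simp_all)

text \<open>Expanding in the standard basis bounds \<open>f\<close> by a multiple \<open>M\<close>
  of the Euclidean norm; the reverse triangle inequality then makes \<open>f\<close> Lipschitz with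
  constant \<open>M\<close>.\<close>

lemma is_norm_continuous:
  fixes f :: "'a::euclidean_space \<Rightarrow> real"
  assumes f: "is_norm f"
  shows "continuous_on S f"
proof -
  define M where "M = (\<Sum>b\<in>Basis. f b)"
  have M: "f x \<le> M * norm x" for x
  proof -
    have "f x = f (\<Sum>b\<in>Basis. (x \<bullet> b) *\<^sub>R b)" by (simp add: euclidean_representation)
    also have "\<dots> \<le> (\<Sum>b\<in>Basis. f ((x \<bullet> b) *\<^sub>R b))" by (rule is_norm_sum_le[OF f])
    also have "\<dots> \<le> (\<Sum>b\<in>Basis. norm x * f b)"
      by (intro sum_mono) (simp add: is_norm_scaleR[OF f] is_norm_nonneg[OF f] Basis_le_norm mult_right_mono)
    finally show ?thesis by (simp add: M_def sum_distrib_left mult.commute)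
  qed
  have "M \<ge> 0" by (simp add: M_def sum_nonneg is_norm_nonneg[OF f])
  moreover have "dist (f x) (f y) \<le> M * dist x y" for x y
    using is_norm_triangle[OF f, of "x - y" y] is_norm_triangle[OF f, of "y - x" x]
      M[of "x - y"] is_norm_minus_commute[OF f, of x y]
    by (simp add: dist_norm dist_real_def abs_le_iff)
  ultimately have "M-lipschitz_on S f" by (intro lipschitz_onI) auto
  then show ?thesis by (rule lipschitz_on_continuous_on)
qed

text \<open>The constant is the minimum of \<open>f\<close> on the compact unit sphere, positive
  because \<open>f\<close> vanishes only at 0.\<close>

lemma is_norm_ge_norm:
  fixes f :: "'a::euclidean_space \<Rightarrow> real"
  assumes f: "is_norm f"
  obtains c where "c > 0" "\<And>x. c * norm x \<le> f x"
proof -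
  have ne: "sphere (0::'a) 1 \<noteq> {}" by simp
  obtain z where z: "z \<in> sphere (0::'a) 1" and min: "\<And>y. y \<in> sphere 0 1 \<Longrightarrow> f z \<le> f y"
    using continuous_attains_inf[OF compact_sphere ne is_norm_continuous[OF f]] by blast
  have "z \<noteq> 0" using z by auto
  then have "f z > 0"
    using is_norm_nonneg[OF f, of z] is_norm_eq_0_iff[OF f, of z] by linarith
  moreover have "f z * norm x \<le> f x" for x
  proof (cases "x = 0")
    case False
    then have "f z \<le> f (x /\<^sub>R norm x)" by (intro min) simp
    also have "\<dots> = f x / norm x" by (simp add: is_norm_scaleR[OF f] divide_inverse)
    finally show ?thesis using False by (simp add: field_simps)
  qed (use is_norm_nonneg[OF f] in simp)
  ultimately show thesis by (rule that)
qed

text \<open>The source of measurability for everything below: projections of level sets, truncated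
  tubes and orthogonal products are all compact because of this.\<close>

lemma compact_lev:
  fixes f :: "'a::euclidean_space \<Rightarrow> real"
  assumes f: "is_norm f"
  shows "compact (lev f t)"
proof -
  obtain c where c: "c > 0" "\<And>x. c * norm x \<le> f x" using is_norm_ge_norm[OF f] by blast
  have "norm x \<le> t / c" if "x \<in> lev f t" for x
    using c(1) c(2)[of x] that by (simp add: lev_def field_simps)
  then have "bounded (lev f t)" unfolding bounded_iff by blast
  moreover have "closed (lev f t)"
    unfolding lev_def by (intro closed_Collect_le is_norm_continuous[OF f] continuous_on_const)
  ultimately show ?thesis by (simp add: compact_eq_bounded_closed)
qed

lemma lev_scaleR:
  assumes f: "is_norm f" and r: "0 < r"
  shows "lev f r = (*\<^sub>R) r ` lev f 1"
proof (intro set_eqI iffI)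
  fix x assume x: "x \<in> lev f r"
  have "x = r *\<^sub>R (x /\<^sub>R r)" using r by simp
  moreover have "x /\<^sub>R r \<in> lev f 1"
    using x r by (simp add: lev_def is_norm_scaleR[OF f] divide_inverse_commute[symmetric])
  ultimately show "x \<in> (*\<^sub>R) r ` lev f 1" by blast
qed (use r in \<open>auto simp: lev_def is_norm_scaleR[OF f]\<close>)

lemma orth_proj_eqI:
  fixes V :: "'a::euclidean_space set"
  assumes V: "subspace V" and "p \<in> V" "x - p \<in> V\<^sup>\<bottom>"
  shows "orth_proj V x = p"
proof -
  let ?q = "orth_proj V x"
  have q: "?q \<in> V" "x - ?q \<in> V\<^sup>\<bottom>" using orth_proj[OF V, of x] by auto
  have "?q - p \<in> V" using q assms by (blast intro: subspace_diff)
  moreover have "(x - p) - (x - ?q) \<in> V\<^sup>\<bottom>"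
    using q assms by (blast intro: subspace_diff subspace_orthogonal_comp)
  ultimately have "?q - p \<in> V \<inter> V\<^sup>\<bottom>" by simp
  then show ?thesis by (simp add: orthogonal_Int_0[OF V])
qed

lemma linear_orth_proj:
  fixes V :: "'a::euclidean_space set"
  assumes V: "subspace V"
  shows "linear (orth_proj V)"
proof (rule linearI)
  have V': "subspace (V\<^sup>\<bottom>)" by (rule subspace_orthogonal_comp)
  fix x y :: 'a and c :: real
  have "(x - orth_proj V x) + (y - orth_proj V y) \<in> V\<^sup>\<bottom>"
    using orth_proj[OF V] V' by (blast intro: subspace_add)
  then show "orth_proj V (x + y) = orth_proj V x + orth_proj V y"
    using orth_proj[OF V] V by (intro orth_proj_eqI) (auto intro: subspace_add simp: algebra_simps)
  have "c *\<^sub>R (x - orth_proj V x) \<in> V\<^sup>\<bottom>"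
    using orth_proj[OF V] V' by (blast intro: subspace_scale)
  then show "orth_proj V (c *\<^sub>R x) = c *\<^sub>R orth_proj V x"
    using orth_proj[OF V] V by (intro orth_proj_eqI) (auto intro: subspace_scale simp: algebra_simps)
qed

lemma compact_orth_proj_lev:
  fixes V :: "'a::euclidean_space set"
  assumes "subspace V" "is_norm f"
  shows "compact (orth_proj V ` lev f t)"
  using assms by (intro compact_continuous_image compact_lev linear_continuous_on
      linear_conv_bounded_linear[THEN iffD1] linear_orth_proj)

lemma orth_proj_lev_scaleR:
  fixes V :: "'a::euclidean_space set"
  assumes V: "subspace V" and f: "is_norm f" and r: "0 < r"
  shows "orth_proj V ` lev f r = (*\<^sub>R) r ` (orth_proj V ` lev f 1)"
  by (simp add: lev_scaleR[OF f r] image_image linear_scale[OF linear_orth_proj[OF V]])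

lemma dim_orthogonal_comp:
  fixes V :: "'a::euclidean_space set"
  assumes "subspace V"
  shows "dim (V\<^sup>\<bottom>) = DIM('a) - dim V"
  using dim_subspace_orthogonal_to_vectors[OF assms subspace_UNIV subset_UNIV]
  by (simp add: orthogonal_comp_def)

subsection \<open>Tubes around spans of dictionary elements\<close>

lemma TJ_subspace [simp]: "subspace (TJ \<psi> J)"
  by (simp add: TJ_def)

text \<open>A vector and its projection to the complement differ by an element of the span, so
  projecting the level set does not change its sum with the span. The tube is thus the set of data
  approximable from the span within \<open>\<tau>\<close>, the form that matches the constraint in
  \<open>val\<close>.\<close>

lemma mem_TJtau_iff:
  assumes nrm: "is_norm nrm"
  shows "d \<in> TJtau nrm \<psi> J \<tau> \<longleftrightarrow> (\<exists>x \<in> TJ \<psi> J. nrm (x - d) \<le> \<tau>)"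
proof -
  let ?V = "TJ \<psi> J"
  let ?P = "orth_proj (?V\<^sup>\<bottom>)"
  have P: "?P e \<in> ?V\<^sup>\<bottom>" "e - ?P e \<in> ?V" for e
    using orth_proj[OF subspace_orthogonal_comp[of ?V], of e]
    by (simp_all add: orthogonal_comp_self)
  show ?thesis
  proof
    assume "d \<in> TJtau nrm \<psi> J \<tau>"
    then obtain x e where "x \<in> ?V" "nrm e \<le> \<tau>" "d = x + ?P e"
      by (auto simp: TJtau_def lev_def)
    \<comment> \<open>The part of \<open>e\<close> removed by the projection is moved into the
      approximant; the remaining error is exactly \<open>- e\<close>.\<close>
    then have "x - (e - ?P e) \<in> ?V" "nrm (x - (e - ?P e) - d) \<le> \<tau>"
      using P(2)[of e] is_norm_minus[OF nrm, of e] by (auto intro: subspace_diff)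
    then show "\<exists>x \<in> ?V. nrm (x - d) \<le> \<tau>" by blast
  next
    assume "\<exists>x \<in> ?V. nrm (x - d) \<le> \<tau>"
    then obtain x where x: "x \<in> ?V" "nrm (d - x) \<le> \<tau>"
      using is_norm_minus_commute[OF nrm] by metis
    let ?e = "d - x"
    have "d = (x + (?e - ?P ?e)) + ?P ?e" by simp
    moreover have "x + (?e - ?P ?e) \<in> ?V" using x(1) P(2) by (intro subspace_add) auto
    moreover have "?P ?e \<in> ?P ` lev nrm \<tau>" using x(2) by (simp add: lev_def)
    ultimately show "d \<in> TJtau nrm \<psi> J \<tau>" unfolding TJtau_def by blast
  qed
qed

text \<open>A tube is in general unbounded, so only closedness is available: a closed subspace plus
  a compact set. Compactness appears after intersecting with a level set of
  \<open>fd\<close>.\<close>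

lemma closed_TJtau:
  assumes nrm: "is_norm nrm"
  shows "closed (TJtau nrm \<psi> J \<tau>)"
proof -
  have "TJtau nrm \<psi> J \<tau> = (\<Union>x\<in>TJ \<psi> J. \<Union>y\<in>orth_proj ((TJ \<psi> J)\<^sup>\<bottom>) ` lev nrm \<tau>. {x + y})"
    by (auto simp: TJtau_def)
  moreover have "closed \<dots>"
    by (intro closed_compact_sums closed_subspace TJ_subspace
        compact_orth_proj_lev[OF subspace_orthogonal_comp nrm])
  ultimately show ?thesis by simp
qed

lemma compact_TJtau_lev:
  assumes "is_norm nrm" "is_norm fd"
  shows "compact (TJtau nrm \<psi> J \<tau> \<inter> lev fd \<theta>)"
  using closed_Int_compact[OF closed_TJtau[OF assms(1)] compact_lev[OF assms(2)]] .

text \<open>\<open>S\<close> is an exact orthogonal product, unlike a tube cut by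
  \<open>lev fd\<close>. Both factors are dilates of their unit versions, since the projection is
  linear and the subspace is invariant under scaling; the two dilations give the two powers.\<close>

lemma measure_orthogonal_tube:
  fixes V :: "'a::euclidean_space set"
  assumes V: "subspace V" and nrm: "is_norm nrm" and fd: "is_norm fd" and "0 < \<tau>" "0 < r"
  defines "S \<equiv> {x + y | x y. x \<in> V \<inter> lev fd r \<and> y \<in> orth_proj (V\<^sup>\<bottom>) ` lev nrm \<tau>}"
  shows "compact S"
    and "measure lebesgue S =
      measure (subspace_lebesgue (V\<^sup>\<bottom>)) (orth_proj (V\<^sup>\<bottom>) ` lev nrm 1) *
      measure (subspace_lebesgue V) (V \<inter> lev fd 1) * \<tau> ^ (DIM('a) - dim V) * r ^ dim V"
proof -
  have V': "subspace (V\<^sup>\<bottom>)" by (rule subspace_orthogonal_comp)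
  have cA: "compact (V \<inter> lev fd t)" for t
    by (rule closed_Int_compact[OF closed_subspace[OF V] compact_lev[OF fd]])
  have cC: "compact (orth_proj (V\<^sup>\<bottom>) ` lev nrm t)" for t
    by (rule compact_orth_proj_lev[OF V' nrm])
  have subC: "orth_proj (V\<^sup>\<bottom>) ` lev nrm t \<subseteq> V\<^sup>\<bottom>" for t
    using orth_proj[OF V'] by blast
  show cS: "compact S"
    unfolding S_def by (rule compact_sums[OF cA cC])
  have A: "V \<inter> lev fd r = (*\<^sub>R) r ` (V \<inter> lev fd 1)"
  proof -
    have "x \<in> (*\<^sub>R) r ` V" if "x \<in> V" for x
      using subspace_scale[OF V that, of "inverse r"] \<open>0 < r\<close> by (intro image_eqI[of _ _ "x /\<^sub>R r"]) auto
    then have "(*\<^sub>R) r ` V = V" using subspace_scale[OF V] by auto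
    moreover have "(*\<^sub>R) r ` (V \<inter> lev fd 1) = (*\<^sub>R) r ` V \<inter> (*\<^sub>R) r ` lev fd 1"
      using \<open>0 < r\<close> by (intro image_Int injI) simp
    ultimately show ?thesis by (simp add: lev_scaleR[OF fd \<open>0 < r\<close>])
  qed
  have mA: "emeasure (subspace_lebesgue V) (V \<inter> lev fd r)
      = ennreal (r ^ dim V) * emeasure (subspace_lebesgue V) (V \<inter> lev fd 1)"
    unfolding A by (rule emeasure_subspace_lebesgue_scaleR[OF V \<open>0 < r\<close>])
      (use cA A in \<open>auto simp flip: A intro: borel_compact\<close>)
  have mC: "emeasure (subspace_lebesgue (V\<^sup>\<bottom>)) (orth_proj (V\<^sup>\<bottom>) ` lev nrm \<tau>)
      = ennreal (\<tau> ^ dim (V\<^sup>\<bottom>)) * emeasure (subspace_lebesgue (V\<^sup>\<bottom>)) (orth_proj (V\<^sup>\<bottom>) ` lev nrm 1)"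
    unfolding orth_proj_lev_scaleR[OF V' nrm \<open>0 < \<tau>\<close>]
    by (rule emeasure_subspace_lebesgue_scaleR[OF V' \<open>0 < \<tau>\<close> _ subC])
      (use cC in \<open>auto simp flip: orth_proj_lev_scaleR[OF V' nrm \<open>0 < \<tau>\<close>] intro: borel_compact\<close>)
  have "emeasure lborel S = emeasure (subspace_lebesgue V) (V \<inter> lev fd r) *
      emeasure (subspace_lebesgue (V\<^sup>\<bottom>)) (orth_proj (V\<^sup>\<bottom>) ` lev nrm \<tau>)"
    using cS unfolding S_def
    by (intro emeasure_lborel_orthogonal_sum[OF V] borel_compact cA cC subC) auto
  then have "measure lborel S = \<tau> ^ dim (V\<^sup>\<bottom>) * r ^ dim V *
      (measure (subspace_lebesgue (V\<^sup>\<bottom>)) (orth_proj (V\<^sup>\<bottom>) ` lev nrm 1) *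
       measure (subspace_lebesgue V) (V \<inter> lev fd 1))"
    using \<open>0 < \<tau>\<close> \<open>0 < r\<close> by (simp add: measure_def mA mC enn2real_mult)
  then show "measure lebesgue S =
      measure (subspace_lebesgue (V\<^sup>\<bottom>)) (orth_proj (V\<^sup>\<bottom>) ` lev nrm 1) *
      measure (subspace_lebesgue V) (V \<inter> lev fd 1) * \<tau> ^ (DIM('a) - dim V) * r ^ dim V"
    using borel_compact[OF cS] by (simp add: dim_orthogonal_comp[OF V])
qed

text \<open>\<open>\<tau>\<close> itself is admissible in the infimum defining \<open>hJ\<close>,
  because the projected level set of radius \<open>\<tau>\<close> is the dilate of the one of radius
  1.\<close>

lemma hJ_le:
  assumes nrm: "is_norm nrm" and \<tau>: "0 < \<tau>" and y: "y \<in> orth_proj ((TJ \<psi> J)\<^sup>\<bottom>) ` lev nrm \<tau>"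
  shows "hJ nrm \<psi> J y \<le> \<tau>"
  unfolding hJ_def
proof (rule cInf_lower)
  show "bdd_below {t. 0 < t \<and> y /\<^sub>R t \<in> orth_proj ((TJ \<psi> J)\<^sup>\<bottom>) ` lev nrm 1}"
    by (rule bdd_belowI[of _ 0]) auto
  show "\<tau> \<in> {t. 0 < t \<and> y /\<^sub>R t \<in> orth_proj ((TJ \<psi> J)\<^sup>\<bottom>) ` lev nrm 1}"
    using y \<tau> by (auto simp: orth_proj_lev_scaleR[OF subspace_orthogonal_comp nrm \<tau>])
qed

lemma measure_TJtau_lev:
  fixes \<psi> :: "'i \<Rightarrow> 'a::euclidean_space"
  assumes nrm: "is_norm nrm" and fd: "is_norm fd" and \<tau>: "0 < \<tau>"
    and \<delta>: "0 \<le> \<delta>" "\<And>u. u \<in> (TJ \<psi> J)\<^sup>\<bottom> \<Longrightarrow> fd u \<le> \<delta> * hJ nrm \<psi> J u"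
    and \<theta>: "0 < \<theta>" "\<delta> * \<tau> \<le> \<theta>"
  defines "K \<equiv> dim (TJ \<psi> J)"
  shows "CJ nrm fd \<psi> J * \<tau> ^ (DIM('a) - K) * (\<theta> - \<delta> * \<tau>) ^ K
      \<le> measure lebesgue (TJtau nrm \<psi> J \<tau> \<inter> lev fd \<theta>)" (is ?lower)
    and "measure lebesgue (TJtau nrm \<psi> J \<tau> \<inter> lev fd \<theta>)
      \<le> CJ nrm fd \<psi> J * \<tau> ^ (DIM('a) - K) * (\<theta> + \<delta> * \<tau>) ^ K" (is ?upper)
proof -
  let ?V = "TJ \<psi> J"
  let ?C = "orth_proj (?V\<^sup>\<bottom>) ` lev nrm \<tau>"
  define S where "S r = {x + y | x y. x \<in> ?V \<inter> lev fd r \<and> y \<in> ?C}" for r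
  have V: "subspace ?V" by simp
  have cS: "compact (S r)"
    and mS: "measure lebesgue (S r) = CJ nrm fd \<psi> J * \<tau> ^ (DIM('a) - K) * r ^ K" if "0 < r" for r
    using measure_orthogonal_tube[OF V nrm fd \<tau> that] by (auto simp: S_def CJ_def K_def)
  have fdC: "fd y \<le> \<delta> * \<tau>" if "y \<in> ?C" for y
  proof -
    have "y \<in> ?V\<^sup>\<bottom>" using that orth_proj[OF subspace_orthogonal_comp[of ?V]] by blast
    then have "fd y \<le> \<delta> * hJ nrm \<psi> J y" by (rule \<delta>(2))
    also have "\<dots> \<le> \<delta> * \<tau>" by (intro mult_left_mono hJ_le[OF nrm \<tau> that] \<delta>(1))
    finally show ?thesis .
  qed
  have pos: "0 < \<theta> + \<delta> * \<tau>" using \<theta> \<delta> \<tau> by (simp add: add_pos_nonneg)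
  have "TJtau nrm \<psi> J \<tau> \<inter> lev fd \<theta> \<subseteq> S (\<theta> + \<delta> * \<tau>)"
  proof
    fix d assume "d \<in> TJtau nrm \<psi> J \<tau> \<inter> lev fd \<theta>"
    then obtain x y where d: "d = x + y" "x \<in> ?V" "y \<in> ?C" "fd (x + y) \<le> \<theta>"
      by (auto simp: TJtau_def lev_def)
    have "fd x \<le> fd (x + y) + fd (- y)" using is_norm_triangle[OF fd, of "x + y" "- y"] by simp
    then have "fd x \<le> \<theta> + \<delta> * \<tau>" using fdC[OF d(3)] d(4) by (simp add: is_norm_minus[OF fd])
    then show "d \<in> S (\<theta> + \<delta> * \<tau>)" using d unfolding S_def lev_def by blast
  qed
  then have "measure lebesgue (TJtau nrm \<psi> J \<tau> \<inter> lev fd \<theta>) \<le> measure lebesgue (S (\<theta> + \<delta> * \<tau>))"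
    by (intro measure_mono_fmeasurable lmeasurable_compact cS pos)
       (auto intro: lmeasurable_compact compact_TJtau_lev nrm fd fmeasurableD)
  then show ?upper by (simp add: mS[OF pos])
  \<comment> \<open>The radius \<open>r\<close> is kept separate from
    \<open>\<theta> - \<delta> * \<tau>\<close>, since the formula \<open>mS\<close> asks for a
    positive radius and the latter may be 0.\<close>
  have S_sub: "S r \<subseteq> TJtau nrm \<psi> J \<tau> \<inter> lev fd \<theta>"
    if r: "\<And>x. x \<in> ?V \<Longrightarrow> fd x \<le> r \<Longrightarrow> fd x \<le> \<theta> - \<delta> * \<tau>" for r
  proof
    fix d assume "d \<in> S r"
    then obtain x y where d: "d = x + y" "x \<in> ?V" "y \<in> ?C" "fd x \<le> r" by (auto simp: S_def lev_def)
    have "fd d \<le> \<theta>"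
      using is_norm_triangle[OF fd, of x y] fdC[OF d(3)] r[OF d(2,4)] by (simp add: d(1))
    then show "d \<in> TJtau nrm \<psi> J \<tau> \<inter> lev fd \<theta>"
      using d unfolding TJtau_def lev_def by blast
  qed
  have lower: "measure lebesgue (S r) \<le> measure lebesgue (TJtau nrm \<psi> J \<tau> \<inter> lev fd \<theta>)"
    if "0 < r" "\<And>x. x \<in> ?V \<Longrightarrow> fd x \<le> r \<Longrightarrow> fd x \<le> \<theta> - \<delta> * \<tau>" for r
    using S_sub[OF that(2)] cS[OF that(1)]
    by (intro measure_mono_fmeasurable lmeasurable_compact compact_TJtau_lev nrm fd)
       (auto intro: lmeasurable_compact fmeasurableD)
  show ?lower
  proof (cases "K = 0")
    \<comment> \<open>Here \<open>0 ^ 0 = 1\<close>, so the lower bound is not trivial even if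
      \<open>\<theta> = \<delta> * \<tau>\<close>. The span is \<open>{0}\<close>, where
      \<open>fd\<close> vanishes, so every positive radius works, for instance 1.\<close>
    case True
    then have "?V \<subseteq> {0}" by (simp add: K_def dim_eq_0)
    then have "fd x \<le> \<theta> - \<delta> * \<tau>" if "x \<in> ?V" for x
      using that \<theta>(2) is_norm_eq_0_iff[OF fd, of 0] by auto
    then show ?thesis using lower[of 1] mS[of 1] True by simp
  next
    case False
    show ?thesis
    proof (cases "\<theta> - \<delta> * \<tau> = 0")
      \<comment> \<open>For \<open>K > 0\<close> a vanishing inner radius makes the left-hand side
        0.\<close>
      case True
      then show ?thesis using \<open>K \<noteq> 0\<close> by (simp add: zero_power)
    next
      case False
      then have "0 < \<theta> - \<delta> * \<tau>" using \<theta>(2) by simp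
      then show ?thesis using lower mS by metis
    qed
  qed
qed

subsection \<open>Sparse approximations and tubes\<close>

text \<open>The family may repeat vectors, whereas \<open>span_finite\<close> yields coefficients
  indexed by vectors. Choosing one index per vector, the set \<open>U\<close>, and extending by 0
  turns these into coefficients on \<open>I\<close>.\<close>

lemma exists_representation:
  fixes \<psi> :: "'i \<Rightarrow> 'a::real_vector"
  assumes "finite I" "x \<in> span (\<psi> ` I)"
  obtains c where "x = (\<Sum>i\<in>I. c i *\<^sub>R \<psi> i)"
proof -
  obtain U where U: "U \<subseteq> I" "inj_on \<psi> U" "\<psi> ` I = \<psi> ` U"
    using subset_image_inj[of "\<psi> ` I" \<psi> I] by blast
  then have fin: "finite U" using assms(1) finite_subset by blast
  have "x \<in> span (\<psi> ` U)" using assms(2) U(3) by simp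
  then obtain g where "x = (\<Sum>v\<in>\<psi> ` U. g v *\<^sub>R v)" using fin by (auto simp: span_finite)
  also have "\<dots> = (\<Sum>i\<in>U. g (\<psi> i) *\<^sub>R \<psi> i)" using U(2) by (simp add: sum.reindex)
  also have "\<dots> = (\<Sum>i\<in>I. (if i \<in> U then g (\<psi> i) else 0) *\<^sub>R \<psi> i)"
    using U(1) assms(1) by (intro sum.mono_neutral_cong_left) auto
  finally show thesis by (rule that)
qed

text \<open>\<open>LEAST\<close> is meaningful only if some coefficient family is feasible. Spanning
  provides one with error 0, so the minimum is attained.\<close>

lemma val_le_iff:
  fixes \<psi> :: "'i \<Rightarrow> 'a::real_vector"
  assumes nrm: "is_norm nrm" and "0 \<le> \<tau>" and "finite I" "span (\<psi> ` I) = UNIV"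
  shows "val nrm I \<psi> \<tau> d \<le> K \<longleftrightarrow>
    (\<exists>c. nrm ((\<Sum>i\<in>I. c i *\<^sub>R \<psi> i) - d) \<le> \<tau> \<and> card {i\<in>I. c i \<noteq> 0} \<le> K)"
proof -
  let ?P = "\<lambda>n. \<exists>c :: 'i \<Rightarrow> real. nrm ((\<Sum>i\<in>I. c i *\<^sub>R \<psi> i) - d) \<le> \<tau> \<and> n = card {i\<in>I. c i \<noteq> 0}"
  have "d \<in> span (\<psi> ` I)" using assms(4) by simp
  then obtain c where "d = (\<Sum>i\<in>I. c i *\<^sub>R \<psi> i)" using exists_representation[OF assms(3)] by blast
  then have "?P (card {i\<in>I. c i \<noteq> 0})"
    using is_norm_eq_0_iff[OF nrm, of 0] assms(2) by (intro exI[of _ c]) simp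
  then have ex: "?P (val nrm I \<psi> \<tau> d)" unfolding val_def by (rule LeastI)
  have le: "val nrm I \<psi> \<tau> d \<le> n" if "?P n" for n
    unfolding val_def using that by (rule Least_le)
  show ?thesis
  proof
    assume "val nrm I \<psi> \<tau> d \<le> K"
    with ex show "\<exists>c. nrm ((\<Sum>i\<in>I. c i *\<^sub>R \<psi> i) - d) \<le> \<tau> \<and> card {i\<in>I. c i \<noteq> 0} \<le> K"
      by auto
  next
    assume "\<exists>c. nrm ((\<Sum>i\<in>I. c i *\<^sub>R \<psi> i) - d) \<le> \<tau> \<and> card {i\<in>I. c i \<noteq> 0} \<le> K"
    then obtain c where c: "nrm ((\<Sum>i\<in>I. c i *\<^sub>R \<psi> i) - d) \<le> \<tau>" "card {i\<in>I. c i \<noteq> 0} \<le> K"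
      by (elim exE conjE)
    have "val nrm I \<psi> \<tau> d \<le> card {i\<in>I. c i \<noteq> 0}"
      by (rule le) (intro exI[of _ c] conjI c(1) refl)
    then show "val nrm I \<psi> \<tau> d \<le> K" using c(2) by (rule le_trans)
  qed
qed

text \<open>Adding one dictionary element raises the dimension by at most one, so a maximal set
  among those of dimension at most \<open>K\<close> must reach \<open>K\<close>: otherwise some
  dictionary vector lies outside its span and can be added. This is needed because the support of a
  sparse family may span fewer than \<open>K\<close> dimensions, while representatives have
  dimension exactly \<open>K\<close>.\<close>

lemma exists_superset_dim:
  fixes \<psi> :: "'i \<Rightarrow> 'a::euclidean_space"
  assumes fin: "finite I" and S: "S \<subseteq> I" "dim (TJ \<psi> S) \<le> K" and K: "K \<le> dim (TJ \<psi> I)"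
  obtains J where "S \<subseteq> J" "J \<subseteq> I" "dim (TJ \<psi> J) = K"
proof -
  let ?F = "{J. S \<subseteq> J \<and> J \<subseteq> I \<and> dim (TJ \<psi> J) \<le> K}"
  have "finite ?F" by (rule finite_subset[of _ "Pow I"]) (use fin in auto)
  moreover have "?F \<noteq> {}" using S by blast
  ultimately have "\<exists>J\<in>?F. \<forall>J'\<in>?F. J \<subseteq> J' \<longrightarrow> J = J'" by (rule finite_has_maximal)
  then obtain J where J: "J \<in> ?F" and max: "\<forall>J'\<in>?F. J \<subseteq> J' \<longrightarrow> J = J'" ..
  have "dim (TJ \<psi> J) = K"
  proof (rule ccontr)
    assume "dim (TJ \<psi> J) \<noteq> K"
    then have less: "dim (TJ \<psi> J) < K" using J by simp
    have "\<not> \<psi> ` I \<subseteq> TJ \<psi> J"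
    proof
      assume "\<psi> ` I \<subseteq> TJ \<psi> J"
      then have "TJ \<psi> I \<subseteq> TJ \<psi> J" using span_minimal[of "\<psi> ` I" "TJ \<psi> J"] by (simp add: TJ_def)
      then show False using less K dim_subset[of "TJ \<psi> I" "TJ \<psi> J"] by linarith
    qed
    then obtain i where i: "i \<in> I" "\<psi> i \<notin> span (\<psi> ` J)" by (auto simp: TJ_def)
    then have "dim (TJ \<psi> (insert i J)) = dim (TJ \<psi> J) + 1"
      by (simp add: TJ_def dim_insert)
    then have "insert i J \<in> ?F" using less J i by auto
    then have "J = insert i J" using max by (simp only: subset_insertI)
    then have "\<psi> i \<in> \<psi> ` J" by blast
    then have "\<psi> i \<in> span (\<psi> ` J)" by (rule span_base)
    with i(2) show False by (rule notE)
  qed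
  then show thesis using J by (intro that) simp_all
qed

text \<open>In one direction the support of the coefficients is enlarged to dimension
  \<open>K\<close> and replaced by the representative with the same span. In the other, a
  \<open>K\<close>-dimensional span has a basis of \<open>K\<close> dictionary vectors, so each of
  its points needs at most \<open>K\<close> nonzero coefficients.\<close>

lemma val_le_iff_TJtau:
  fixes \<psi> :: "'i \<Rightarrow> 'a::euclidean_space"
  assumes nrm: "is_norm nrm" and \<tau>: "0 \<le> \<tau>" and fin: "finite I" and span: "span (\<psi> ` I) = UNIV"
    and K: "K \<le> DIM('a)" and rep: "span_representatives I \<psi> K \<J>"
  shows "val nrm I \<psi> \<tau> d \<le> K \<longleftrightarrow> d \<in> (\<Union>J\<in>\<J>. TJtau nrm \<psi> J \<tau>)"
proof
  assume "val nrm I \<psi> \<tau> d \<le> K"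
  then obtain c where c: "nrm ((\<Sum>i\<in>I. c i *\<^sub>R \<psi> i) - d) \<le> \<tau>" "card {i\<in>I. c i \<noteq> 0} \<le> K"
    using val_le_iff[OF nrm \<tau> fin span] by blast
  let ?S = "{i\<in>I. c i \<noteq> 0}"
  have finS: "finite ?S" using fin by simp
  have "dim (TJ \<psi> ?S) \<le> card (\<psi> ` ?S)"
    unfolding TJ_def dim_span using finS by (intro dim_le_card') auto
  also have "\<dots> \<le> card ?S" by (rule card_image_le[OF finS])
  finally have "dim (TJ \<psi> ?S) \<le> K" using c(2) by simp
  moreover have "dim (TJ \<psi> I) = DIM('a)" by (simp add: TJ_def span)
  ultimately obtain J1 where J1: "?S \<subseteq> J1" "J1 \<subseteq> I" "dim (TJ \<psi> J1) = K"
    using exists_superset_dim[OF fin, of ?S \<psi> K] K by auto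
  have "\<exists>J\<in>\<J>. TJ \<psi> J = TJ \<psi> J1"
    using rep J1(2,3) by (simp add: span_representatives_def)
  then obtain J where J: "J \<in> \<J>" "TJ \<psi> J = TJ \<psi> J1" ..
  have summand: "c i *\<^sub>R \<psi> i \<in> TJ \<psi> J1" if "i \<in> I" for i
  proof (cases "c i = 0")
    case False
    then have "i \<in> J1" using that J1(1) by blast
    then show ?thesis unfolding TJ_def by (intro span_scale span_base imageI)
  qed (simp add: TJ_def span_zero)
  have "(\<Sum>i\<in>I. c i *\<^sub>R \<psi> i) \<in> TJ \<psi> J"
    unfolding J(2) by (rule subspace_sum[OF TJ_subspace summand])
  with c(1) have "d \<in> TJtau nrm \<psi> J \<tau>"
    unfolding mem_TJtau_iff[OF nrm] by (rule bexI)
  then show "d \<in> (\<Union>J\<in>\<J>. TJtau nrm \<psi> J \<tau>)" using J(1) by (rule UN_I[rotated])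
next
  assume "d \<in> (\<Union>J\<in>\<J>. TJtau nrm \<psi> J \<tau>)"
  then obtain J x where J: "J \<in> \<J>" "x \<in> TJ \<psi> J" "nrm (x - d) \<le> \<tau>"
    by (auto simp: mem_TJtau_iff[OF nrm])
  have JI: "J \<subseteq> I" and dimJ: "dim (TJ \<psi> J) = K" using rep J(1) by (auto simp: span_representatives_def)
  \<comment> \<open>\<open>J\<close> may contain more than \<open>K\<close> indices; only a set
    \<open>U\<close> of indices of a basis gives the required sparsity.\<close>
  obtain B where B: "B \<subseteq> \<psi> ` J" "independent B" "\<psi> ` J \<subseteq> span B" "card B = dim (\<psi> ` J)"
    using basis_exists[of "\<psi> ` J"] by blast
  obtain U where U: "U \<subseteq> J" "inj_on \<psi> U" "B = \<psi> ` U"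
    using B(1) subset_image_inj[of B \<psi> J] by blast
  have finU: "finite U" by (rule finite_subset[OF subset_trans[OF U(1) JI] fin])
  have "card U = dim (\<psi> ` J)" using B(4) card_image[OF U(2)] by (simp only: U(3))
  also have "\<dots> = K" using dimJ by (simp add: TJ_def)
  finally have cardU: "card U = K" .
  have "TJ \<psi> J \<subseteq> span (\<psi> ` U)"
    using span_minimal[OF B(3)] U(3) by (simp add: TJ_def)
  then obtain c where c: "x = (\<Sum>i\<in>U. c i *\<^sub>R \<psi> i)"
    using exists_representation[OF finU] J(2) by blast
  let ?c = "\<lambda>i. if i \<in> U then c i else 0"
  have "x = (\<Sum>i\<in>I. ?c i *\<^sub>R \<psi> i)"
    unfolding c using U(1) JI fin by (intro sum.mono_neutral_cong_left) auto
  moreover have "card {i\<in>I. ?c i \<noteq> 0} \<le> K"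
    unfolding cardU[symmetric] by (rule card_mono[OF finU]) auto
  ultimately show "val nrm I \<psi> \<tau> d \<le> K"
    unfolding val_le_iff[OF nrm \<tau> fin span] using J(3) by (intro exI[of _ ?c]) simp
qed

subsection \<open>Measure of the sets of data with prescribed value\<close>

text \<open>Adding \<open>A a\<close> to the union loses the measure of its intersection with the
  earlier sets, at most the sum of the pairwise overlaps. Ordered pairs are summed because the
  collections \<open>HKk\<close> consist of ordered pairs.\<close>

lemma measure_UNION_ge:
  assumes "finite S" "\<And>i. i \<in> S \<Longrightarrow> A i \<in> fmeasurable M"
  shows "(\<Sum>i\<in>S. measure M (A i)) - (\<Sum>(i, j) \<in> {(i, j). i \<in> S \<and> j \<in> S \<and> i \<noteq> j}. measure M (A i \<inter> A j))
    \<le> measure M (\<Union>i\<in>S. A i)"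
  using assms
proof (induction S rule: finite_induct)
  case (insert a S)
  let ?D = "\<lambda>S. {(i, j). i \<in> S \<and> j \<in> S \<and> i \<noteq> j}"
  let ?m = "\<lambda>(i, j). measure M (A i \<inter> A j)"
  have U: "(\<Union>i\<in>S. A i) \<in> fmeasurable M" using insert by (intro fmeasurable.finite_UN) auto
  have fin: "finite (?D T)" if "finite T" for T :: "'a set"
    by (rule finite_subset[of _ "T \<times> T"]) (use that in auto)
  have "measure M (A a \<inter> (\<Union>i\<in>S. A i)) \<le> (\<Sum>j\<in>S. measure M (A a \<inter> A j))"
    unfolding Int_UN_distrib using insert.hyps insert.prems
    by (intro measure_UNION_le) (auto intro: fmeasurableD)
  also have "\<dots> = (\<Sum>p\<in>Pair a ` S. ?m p)"
    by (simp add: sum.reindex inj_on_def)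
  finally have a: "measure M (A a \<inter> (\<Union>i\<in>S. A i)) \<le> (\<Sum>p\<in>Pair a ` S. ?m p)" .
  have "(\<Sum>p\<in>?D S. ?m p) + (\<Sum>p\<in>Pair a ` S. ?m p) = (\<Sum>p\<in>?D S \<union> Pair a ` S. ?m p)"
    using insert.hyps fin by (intro sum.union_disjoint[symmetric]) auto
  \<comment> \<open>The induction spends only the pairs \<open>(a, j)\<close>; their mirror images
    have nonnegative measure and may be added.\<close>
  also have "\<dots> \<le> (\<Sum>p\<in>?D (insert a S). ?m p)"
    using insert.hyps by (intro sum_mono2 fin) auto
  finally have D: "(\<Sum>p\<in>?D S. ?m p) + (\<Sum>p\<in>Pair a ` S. ?m p) \<le> (\<Sum>p\<in>?D (insert a S). ?m p)" .
  have "measure M (A a \<union> (\<Union>i\<in>S. A i)) =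
      measure M (A a) + measure M (\<Union>i\<in>S. A i) - measure M (A a \<inter> (\<Union>i\<in>S. A i))"
    using measure_Un3[of "A a" M "\<Union>i\<in>S. A i"] U insert.prems by simp
  then show ?case using insert a D by simp
qed simp

text \<open>Distributes \<open>\<theta> ^ N\<close> as
  \<open>\<theta> ^ (N - k) * \<theta> ^ k\<close> over the two powers. It translates between the
  error terms, written in \<open>\<tau> / \<theta>\<close>, and the tube bounds.\<close>

lemma power_mult_homogeneous:
  fixes \<theta> :: real
  assumes "\<theta> \<noteq> 0" "k \<le> N"
  shows "\<theta> ^ N * ((\<tau> / \<theta>) ^ (N - k) * (1 + a * (\<tau> / \<theta>)) ^ k) = \<tau> ^ (N - k) * (\<theta> + a * \<tau>) ^ k"
proof -
  have "\<theta> ^ N = \<theta> ^ (N - k) * \<theta> ^ k" using assms(2) by (simp flip: power_add)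
  then have "\<theta> ^ N * ((\<tau> / \<theta>) ^ (N - k) * (1 + a * (\<tau> / \<theta>)) ^ k)
      = (\<theta> * (\<tau> / \<theta>)) ^ (N - k) * (\<theta> * (1 + a * (\<tau> / \<theta>))) ^ k"
    by (simp only: power_mult_distrib mult_ac)
  moreover have "\<theta> * (\<tau> / \<theta>) = \<tau>" "\<theta> * (1 + a * (\<tau> / \<theta>)) = \<theta> + a * \<tau>"
    using assms(1) by (simp_all add: field_simps)
  ultimately show ?thesis by simp
qed

section \<open>The dictionary setting: constants and pairwise overlaps\<close>

locale dictionary_measure =
  fixes nrm fd :: "'a::euclidean_space \<Rightarrow> real"
    and I :: "'i set" and \<psi> :: "'i \<Rightarrow> 'a"
    and \<delta>\<^sub>2 :: real
    and \<delta>J :: "'i set \<Rightarrow> real" and \<delta>JJ :: "'i set \<Rightarrow> 'i set \<Rightarrow> real"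
    and \<J> :: "nat \<Rightarrow> 'i set set"
  assumes nrm: "is_norm nrm" and fd: "is_norm fd"
    and finite_I: "finite I" and span_I: "span (\<psi> ` I) = UNIV"
    and \<delta>J_nonneg: "\<And>J. J \<subseteq> I \<Longrightarrow> 0 \<le> \<delta>J J"
    and fd_le_hJ: "\<And>J u. J \<subseteq> I \<Longrightarrow> u \<in> (TJ \<psi> J)\<^sup>\<bottom> \<Longrightarrow> fd u \<le> \<delta>J J * hJ nrm \<psi> J u"
    and reps: "\<And>L. L \<le> DIM('a) \<Longrightarrow> span_representatives I \<psi> L (\<J> L)"
    and \<delta>JJ_nonneg: "\<And>L k J1 J2. L \<le> DIM('a) \<Longrightarrow> k < L \<Longrightarrow> (J1, J2) \<in> HKk \<psi> \<J> L k \<Longrightarrow> 0 \<le> \<delta>JJ J1 J2"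
    and measure_overlap: "\<And>L k J1 J2 t r. L \<le> DIM('a) \<Longrightarrow> k < L \<Longrightarrow> (J1, J2) \<in> HKk \<psi> \<J> L k \<Longrightarrow>
           0 < t \<Longrightarrow> 0 < r \<Longrightarrow> \<delta>JJ J1 J2 * t \<le> r \<Longrightarrow>
           measure lebesgue (TJtau nrm \<psi> J1 t \<inter> TJtau nrm \<psi> J2 t \<inter> lev fd r)
             \<le> QJJ fd \<delta>\<^sub>2 \<psi> J1 J2 * t ^ (DIM('a) - k) * (r + \<delta>JJ J1 J2 * t) ^ k"
begin

lemma rep_subset: "L \<le> DIM('a) \<Longrightarrow> J \<in> \<J> L \<Longrightarrow> J \<subseteq> I"
  and rep_dim: "L \<le> DIM('a) \<Longrightarrow> J \<in> \<J> L \<Longrightarrow> dim (TJ \<psi> J) = L"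
  and rep_inj: "L \<le> DIM('a) \<Longrightarrow> inj_on (TJ \<psi>) (\<J> L)"
  using reps[of L] by (auto simp: span_representatives_def)

lemma finite_reps: "L \<le> DIM('a) \<Longrightarrow> finite (\<J> L)"
  by (rule finite_subset[of _ "Pow I"]) (use rep_subset finite_I in auto)

lemma delta_hat_ge: "L \<le> DIM('a) \<Longrightarrow> J \<in> \<J> L \<Longrightarrow> \<delta>J J \<le> delta_hat \<J> \<delta>J L"
  unfolding delta_hat_def by (intro Max_ge) (auto simp: finite_reps)

lemma finite_HKk: "L \<le> DIM('a) \<Longrightarrow> finite (HKk \<psi> \<J> L k)"
  by (rule finite_subset[of _ "\<J> L \<times> \<J> L"]) (auto simp: HKk_def finite_reps)

lemma delta_hat'_ge:
  assumes "L \<le> DIM('a)" "(J1, J2) \<in> HKk \<psi> \<J> L k"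
  shows "\<delta>JJ J1 J2 \<le> delta_hat' \<psi> \<J> \<delta>JJ L k"
  unfolding delta_hat'_def using assms by (intro Max_ge) (auto simp: finite_HKk intro!: rev_image_eqI)

lemma Delta_ge_delta_hat: "delta_hat \<J> \<delta>J L \<le> Delta \<psi> \<J> \<delta>J \<delta>JJ L"
  by (cases L) auto

lemma Delta_ge_delta_hat':
  assumes "0 < L" "L < DIM('a)" "k \<in> {2 * L - DIM('a)..L - 1}"
  shows "delta_hat' \<psi> \<J> \<delta>JJ L k \<le> Delta \<psi> \<J> \<delta>J \<delta>JJ L"
proof (cases L)
  case (Suc M)
  let ?S = "{Delta \<psi> \<J> \<delta>J \<delta>JJ M, delta_hat \<J> \<delta>J (Suc M)} \<union>
      delta_hat' \<psi> \<J> \<delta>JJ (Suc M) ` {2 * Suc M - DIM('a)..M}"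
  have "Delta \<psi> \<J> \<delta>J \<delta>JJ L = Max ?S"
    using assms(2) unfolding Suc Delta.simps by (simp only: if_True)
  moreover have "delta_hat' \<psi> \<J> \<delta>JJ L k \<in> ?S"
    using assms(3) unfolding Suc diff_Suc_1 by (intro UnI2 imageI)
  ultimately show ?thesis by (simp only: Max_ge finite_Un finite_insert finite.emptyI finite_imageI finite_atLeastAtMost)
qed (use assms in simp)

lemma Delta_mono: "L \<le> M \<Longrightarrow> Delta \<psi> \<J> \<delta>J \<delta>JJ L \<le> Delta \<psi> \<J> \<delta>J \<delta>JJ M"
proof (induction M rule: dec_induct)
  case (step M)
  have "Delta \<psi> \<J> \<delta>J \<delta>JJ M \<le> Delta \<psi> \<J> \<delta>J \<delta>JJ (Suc M)" by simp
  then show ?case using step by linarith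
qed simp

text \<open>This forces \<open>\<theta> > 0\<close> in the theorem, so the quotient \<open>\<tau> / \<theta>\<close> never takes the junk value.\<close>

lemma Delta_0_pos: "0 < Delta \<psi> \<J> \<delta>J \<delta>JJ 0"
proof -
  obtain J where J: "J \<in> \<J> 0"
    using reps[of 0] by (auto simp: span_representatives_def TJ_def dest!: spec[of _ "{}"])
  then have JI: "J \<subseteq> I" and "dim (TJ \<psi> J) = 0" using rep_subset[of 0] rep_dim[of 0] by auto
  then have "TJ \<psi> J \<subseteq> {0}" by (simp add: dim_eq_0)
  \<comment> \<open>In dimension 0 the estimate of \<open>fd\<close> by \<open>hJ\<close> holds on
    the whole space; a zero constant would force the norm \<open>fd\<close> to vanish on a basis
    vector.\<close>
  then have comp: "(TJ \<psi> J)\<^sup>\<bottom> = UNIV" by (auto simp: orthogonal_comp_def orthogonal_def)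
  obtain b :: 'a where b: "b \<in> Basis" using nonempty_Basis by blast
  then have "fd b > 0" using is_norm_nonneg[OF fd, of b] is_norm_eq_0_iff[OF fd, of b] nonzero_Basis
    by fastforce
  then have "\<delta>J J \<noteq> 0" using fd_le_hJ[OF JI, of b] comp by auto
  then have "0 < \<delta>J J" using \<delta>J_nonneg[OF JI] by simp
  also have "\<dots> \<le> delta_hat \<J> \<delta>J 0" by (rule delta_hat_ge[OF _ J]) simp
  finally show ?thesis by simp
qed

lemma QJJ_nonneg: "0 \<le> QJJ fd \<delta>\<^sub>2 \<psi> J1 J2"
  by (simp add: QJJ_def Let_def)

lemma CJ_nonneg: "0 \<le> CJ nrm fd \<psi> J"
  by (simp add: CJ_def)

text \<open>The dimension formula, with the sum of two spans inside the whole space, bounds the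
  dimension of the intersection from below; an intersection of dimension \<open>K\<close> would make
  the spans, and by injectivity the representatives, equal. Hence the range of \<open>k\<close> in
  \<open>eps0\<close> captures every overlap.\<close>

lemma HKk_eq_distinct_pairs:
  assumes "0 < K" "K < DIM('a)"
  shows "{(J1, J2). J1 \<in> \<J> K \<and> J2 \<in> \<J> K \<and> J1 \<noteq> J2} = (\<Union>k\<in>{2 * K - DIM('a)..K - 1}. HKk \<psi> \<J> K k)"
proof -
  have "dim (TJ \<psi> J1 \<inter> TJ \<psi> J2) \<in> {2 * K - DIM('a)..K - 1} \<longleftrightarrow> J1 \<noteq> J2"
    if J: "J1 \<in> \<J> K" "J2 \<in> \<J> K" for J1 J2
  proof -
    have d: "dim (TJ \<psi> J1) = K" "dim (TJ \<psi> J2) = K" using rep_dim J assms by auto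
    have "dim (TJ \<psi> J1 \<inter> TJ \<psi> J2) \<le> K"
      using dim_subset[of "TJ \<psi> J1 \<inter> TJ \<psi> J2" "TJ \<psi> J1"] d by simp
    moreover have "dim (TJ \<psi> J1 \<inter> TJ \<psi> J2) \<noteq> K" if "J1 \<noteq> J2"
    proof
      assume "dim (TJ \<psi> J1 \<inter> TJ \<psi> J2) = K"
      then have "TJ \<psi> J1 \<inter> TJ \<psi> J2 = TJ \<psi> J1" "TJ \<psi> J1 \<inter> TJ \<psi> J2 = TJ \<psi> J2"
        using d by (simp_all add: subspace_dim_equal subspace_inter)
      then have "TJ \<psi> J1 = TJ \<psi> J2" by simp
      then show False using that rep_inj[of K] J assms by (auto dest: inj_onD)
    qed
    moreover have "2 * K \<le> DIM('a) + dim (TJ \<psi> J1 \<inter> TJ \<psi> J2)"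
      using dim_sums_Int[of "TJ \<psi> J1" "TJ \<psi> J2"] d
        dim_subset_UNIV[of "{x + y |x y. x \<in> TJ \<psi> J1 \<and> y \<in> TJ \<psi> J2}"] by simp
    ultimately show ?thesis using d assms
      by (cases "J1 = J2") (auto simp: le_diff_conv)
  qed
  then show ?thesis unfolding HKk_def by blast
qed

text \<open>\<open>{0}\<close> and the whole space are the only subspaces of their dimensions, and
  representatives have distinct spans. This matches the value 0 of \<open>eps0\<close> at both
  ends.\<close>

lemma no_distinct_pairs:
  assumes "K = 0 \<or> K = DIM('a)"
  shows "{(J1, J2). J1 \<in> \<J> K \<and> J2 \<in> \<J> K \<and> J1 \<noteq> J2} = {}"
proof -
  have K: "K \<le> DIM('a)" using assms by auto
  have "J1 = J2" if J: "J1 \<in> \<J> K" "J2 \<in> \<J> K" for J1 J2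
  proof -
    have d: "dim (TJ \<psi> J1) = K" "dim (TJ \<psi> J2) = K" using rep_dim[OF K] J by auto
    have "TJ \<psi> J1 = TJ \<psi> J2"
      using assms
    proof
      assume "K = 0"
      then have "TJ \<psi> J1 \<subseteq> {0}" "TJ \<psi> J2 \<subseteq> {0}" using d by (simp_all add: dim_eq_0)
      moreover have "0 \<in> TJ \<psi> J1" "0 \<in> TJ \<psi> J2" by (simp_all add: subspace_0)
      ultimately show ?thesis by blast
    next
      assume "K = DIM('a)"
      then have "span (TJ \<psi> J1) = UNIV" "span (TJ \<psi> J2) = UNIV" using d by (simp_all add: dim_eq_full)
      then show ?thesis by (simp add: TJ_def span_span)
    qed
    then show ?thesis using rep_inj[OF K] J by (auto dest: inj_onD)
  qed
  then show ?thesis by blast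
qed

text \<open>Pairs are grouped by the dimension \<open>k\<close> of the intersection. Since
  \<open>Delta\<close> dominates every \<open>delta_hat'\<close> at level \<open>K\<close>, the
  assumption on \<open>\<theta>\<close> permits the overlap estimate for each pair.\<close>

lemma sum_overlap_le:
  assumes K: "K \<le> DIM('a)" and \<tau>: "0 < \<tau>" and \<theta>: "0 < \<theta>" "\<tau> * Delta \<psi> \<J> \<delta>J \<delta>JJ K \<le> \<theta>"
  shows "(\<Sum>(J1, J2) \<in> {(J1, J2). J1 \<in> \<J> K \<and> J2 \<in> \<J> K \<and> J1 \<noteq> J2}.
      measure lebesgue ((TJtau nrm \<psi> J1 \<tau> \<inter> lev fd \<theta>) \<inter> (TJtau nrm \<psi> J2 \<tau> \<inter> lev fd \<theta>)))
    \<le> \<theta> ^ DIM('a) * eps0 fd \<delta>\<^sub>2 \<psi> \<J> \<delta>JJ K \<tau> \<theta>" (is "sum ?m _ \<le> _")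
proof (cases "0 < K \<and> K < DIM('a)")
  case False
  then have "K = 0 \<or> K = DIM('a)" using K by linarith
  then show ?thesis by (subst no_distinct_pairs) (use False in \<open>auto simp: eps0_def\<close>)
next
  case True
  then have KN: "0 < K" "K < DIM('a)" by auto
  let ?R = "{2 * K - DIM('a)..K - 1}"
  let ?d = "\<lambda>k. delta_hat' \<psi> \<J> \<delta>JJ K k"
  have "sum ?m {(J1, J2). J1 \<in> \<J> K \<and> J2 \<in> \<J> K \<and> J1 \<noteq> J2} = (\<Sum>k\<in>?R. sum ?m (HKk \<psi> \<J> K k))"
    unfolding HKk_eq_distinct_pairs[OF KN]
    by (rule sum.UNION_disjoint) (use finite_HKk[OF K] in \<open>auto simp: HKk_def\<close>)
  also have "\<dots> \<le> (\<Sum>k\<in>?R. \<theta> ^ DIM('a) * (Q_bar fd \<delta>\<^sub>2 \<psi> \<J> K k * (\<tau> / \<theta>) ^ (DIM('a) - k) * (1 + ?d k * (\<tau> / \<theta>)) ^ k))"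
  proof (rule sum_mono)
    fix k assume k: "k \<in> ?R"
    then have kK: "k < K" "k \<le> DIM('a)" using KN by auto
    have "sum ?m (HKk \<psi> \<J> K k) \<le> (\<Sum>(J1, J2)\<in>HKk \<psi> \<J> K k. QJJ fd \<delta>\<^sub>2 \<psi> J1 J2 * (\<tau> ^ (DIM('a) - k) * (\<theta> + ?d k * \<tau>) ^ k))"
    proof (rule sum_mono, clarify)
      fix J1 J2 assume J: "(J1, J2) \<in> HKk \<psi> \<J> K k"
      have \<delta>: "0 \<le> \<delta>JJ J1 J2" "\<delta>JJ J1 J2 \<le> ?d k"
        using \<delta>JJ_nonneg[OF K kK(1) J] delta_hat'_ge[OF K J] by auto
      have "\<delta>JJ J1 J2 * \<tau> \<le> Delta \<psi> \<J> \<delta>J \<delta>JJ K * \<tau>"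
        using \<delta>(2) Delta_ge_delta_hat'[OF KN k] \<tau> by (intro mult_right_mono) auto
      then have le: "\<delta>JJ J1 J2 * \<tau> \<le> \<theta>" using \<theta>(2) by (simp add: mult.commute)
      have "(TJtau nrm \<psi> J1 \<tau> \<inter> lev fd \<theta>) \<inter> (TJtau nrm \<psi> J2 \<tau> \<inter> lev fd \<theta>)
          = TJtau nrm \<psi> J1 \<tau> \<inter> TJtau nrm \<psi> J2 \<tau> \<inter> lev fd \<theta>" by blast
      then have "measure lebesgue ((TJtau nrm \<psi> J1 \<tau> \<inter> lev fd \<theta>) \<inter> (TJtau nrm \<psi> J2 \<tau> \<inter> lev fd \<theta>))
          \<le> QJJ fd \<delta>\<^sub>2 \<psi> J1 J2 * \<tau> ^ (DIM('a) - k) * (\<theta> + \<delta>JJ J1 J2 * \<tau>) ^ k"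
        using measure_overlap[OF K kK(1) J \<tau> \<theta>(1) le] by simp
      \<comment> \<open>Passing to the maximal constant makes the bound uniform within the group;
        monotonicity of the power uses that \<open>\<theta> + \<delta>JJ J1 J2 * \<tau>\<close> is
        nonnegative.\<close>
      also have "\<dots> \<le> QJJ fd \<delta>\<^sub>2 \<psi> J1 J2 * \<tau> ^ (DIM('a) - k) * (\<theta> + ?d k * \<tau>) ^ k"
        using \<delta> \<tau> \<theta>(1) QJJ_nonneg by (intro mult_left_mono power_mono add_left_mono mult_right_mono) auto
      finally show "measure lebesgue ((TJtau nrm \<psi> J1 \<tau> \<inter> lev fd \<theta>) \<inter> (TJtau nrm \<psi> J2 \<tau> \<inter> lev fd \<theta>))
          \<le> QJJ fd \<delta>\<^sub>2 \<psi> J1 J2 * (\<tau> ^ (DIM('a) - k) * (\<theta> + ?d k * \<tau>) ^ k)"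
        by (simp add: mult.assoc)
    qed
    also have "\<dots> = Q_bar fd \<delta>\<^sub>2 \<psi> \<J> K k * (\<tau> ^ (DIM('a) - k) * (\<theta> + ?d k * \<tau>) ^ k)"
      by (simp add: Q_bar_def sum_distrib_right split_beta)
    also have "\<dots> = \<theta> ^ DIM('a) * (Q_bar fd \<delta>\<^sub>2 \<psi> \<J> K k * (\<tau> / \<theta>) ^ (DIM('a) - k) * (1 + ?d k * (\<tau> / \<theta>)) ^ k)"
      using \<theta>(1) by (subst power_mult_homogeneous[OF _ kK(2), symmetric, of \<theta>]) (auto simp: mult_ac)
    finally show "sum ?m (HKk \<psi> \<J> K k) \<le>
      \<theta> ^ DIM('a) * (Q_bar fd \<delta>\<^sub>2 \<psi> \<J> K k * (\<tau> / \<theta>) ^ (DIM('a) - k) * (1 + ?d k * (\<tau> / \<theta>)) ^ k)" .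
  qed
  also have "\<dots> = \<theta> ^ DIM('a) * eps0 fd \<delta>\<^sub>2 \<psi> \<J> \<delta>JJ K \<tau> \<theta>"
    using KN by (simp add: eps0_def sum_distrib_left)
  finally show ?thesis .
qed

section \<open>Sublevel sets of \<open>val\<close> and their differences\<close>

definition sublevel :: "nat \<Rightarrow> real \<Rightarrow> real \<Rightarrow> 'a set" where
  "sublevel K \<tau> \<theta> = {d. val nrm I \<psi> \<tau> d \<le> K} \<inter> lev fd \<theta>"

lemma sublevel_eq:
  assumes "K \<le> DIM('a)" "0 \<le> \<tau>"
  shows "sublevel K \<tau> \<theta> = (\<Union>J\<in>\<J> K. TJtau nrm \<psi> J \<tau> \<inter> lev fd \<theta>)"
  using val_le_iff_TJtau[OF nrm assms(2) finite_I span_I assms(1) reps[OF assms(1)]]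
  by (auto simp: sublevel_def)

lemma sublevel_lmeasurable:
  assumes "K \<le> DIM('a)" "0 \<le> \<tau>"
  shows "sublevel K \<tau> \<theta> \<in> lmeasurable"
  unfolding sublevel_eq[OF assms]
  by (intro fmeasurable.finite_UN finite_reps assms lmeasurable_compact compact_TJtau_lev nrm fd)

text \<open>Replacing each \<open>\<delta>J J\<close> by the maximum \<open>delta_hat\<close>
  weakens both tube bounds and makes them uniform, so that summation produces \<open>C_bar\<close>.
  Overlaps cost \<open>eps0\<close> only in the lower bound.\<close>

lemma measure_sublevel:
  assumes K: "K \<le> DIM('a)" and \<tau>: "0 < \<tau>" and \<theta>: "0 < \<theta>" "\<tau> * Delta \<psi> \<J> \<delta>J \<delta>JJ K \<le> \<theta>"
  shows "C_bar nrm fd \<psi> \<J> K * \<tau> ^ (DIM('a) - K) * (\<theta> - delta_hat \<J> \<delta>J K * \<tau>) ^ K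
      - \<theta> ^ DIM('a) * eps0 fd \<delta>\<^sub>2 \<psi> \<J> \<delta>JJ K \<tau> \<theta> \<le> measure lebesgue (sublevel K \<tau> \<theta>)" (is ?lower)
    and "measure lebesgue (sublevel K \<tau> \<theta>)
      \<le> C_bar nrm fd \<psi> \<J> K * \<tau> ^ (DIM('a) - K) * (\<theta> + delta_hat \<J> \<delta>J K * \<tau>) ^ K" (is ?upper)
proof -
  let ?A = "\<lambda>J. TJtau nrm \<psi> J \<tau> \<inter> lev fd \<theta>"
  let ?d = "delta_hat \<J> \<delta>J K"
  have A: "?A J \<in> lmeasurable" for J
    by (intro lmeasurable_compact compact_TJtau_lev nrm fd)
  \<comment> \<open>The inner radius with the maximal constant must be nonnegative for its power to
    be monotone.\<close>
  have "?d * \<tau> \<le> Delta \<psi> \<J> \<delta>J \<delta>JJ K * \<tau>"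
    using \<tau> Delta_ge_delta_hat by (intro mult_right_mono) auto
  then have d\<theta>: "?d * \<tau> \<le> \<theta>" using \<theta>(2) by (simp add: mult.commute)
  have bounds: "CJ nrm fd \<psi> J * (\<tau> ^ (DIM('a) - K) * (\<theta> - ?d * \<tau>) ^ K) \<le> measure lebesgue (?A J)"
    "measure lebesgue (?A J) \<le> CJ nrm fd \<psi> J * (\<tau> ^ (DIM('a) - K) * (\<theta> + ?d * \<tau>) ^ K)"
    if J: "J \<in> \<J> K" for J
  proof -
    have JI: "J \<subseteq> I" and dimJ: "dim (TJ \<psi> J) = K" using rep_subset[OF K J] rep_dim[OF K J] by auto
    have dJ: "\<delta>J J * \<tau> \<le> ?d * \<tau>" using delta_hat_ge[OF K J] \<tau> by simp
    have "0 \<le> \<delta>J J * \<tau>" using \<delta>J_nonneg[OF JI] \<tau> by simp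
    note m = measure_TJtau_lev[OF nrm fd \<tau> \<delta>J_nonneg[OF JI] fd_le_hJ[OF JI] \<theta>(1) order_trans[OF dJ d\<theta>], unfolded dimJ]
    have "CJ nrm fd \<psi> J * \<tau> ^ (DIM('a) - K) * (\<theta> - ?d * \<tau>) ^ K
        \<le> CJ nrm fd \<psi> J * \<tau> ^ (DIM('a) - K) * (\<theta> - \<delta>J J * \<tau>) ^ K"
      using dJ d\<theta> \<tau> CJ_nonneg by (intro mult_left_mono power_mono) auto
    then show "CJ nrm fd \<psi> J * (\<tau> ^ (DIM('a) - K) * (\<theta> - ?d * \<tau>) ^ K) \<le> measure lebesgue (?A J)"
      using m(1) by (simp add: mult.assoc)
    have "CJ nrm fd \<psi> J * \<tau> ^ (DIM('a) - K) * (\<theta> + \<delta>J J * \<tau>) ^ K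
        \<le> CJ nrm fd \<psi> J * \<tau> ^ (DIM('a) - K) * (\<theta> + ?d * \<tau>) ^ K"
      using dJ \<open>0 \<le> \<delta>J J * \<tau>\<close> \<theta>(1) \<tau> CJ_nonneg by (intro mult_left_mono power_mono) auto
    then show "measure lebesgue (?A J) \<le> CJ nrm fd \<psi> J * (\<tau> ^ (DIM('a) - K) * (\<theta> + ?d * \<tau>) ^ K)"
      using m(2) by (simp add: mult.assoc)
  qed
  have U: "sublevel K \<tau> \<theta> = (\<Union>J\<in>\<J> K. ?A J)" using sublevel_eq[OF K] \<tau> by simp
  have "C_bar nrm fd \<psi> \<J> K * (\<tau> ^ (DIM('a) - K) * (\<theta> - ?d * \<tau>) ^ K) \<le> (\<Sum>J\<in>\<J> K. measure lebesgue (?A J))"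
    unfolding C_bar_def sum_distrib_right by (intro sum_mono bounds)
  then show ?lower
    using measure_UNION_ge[of "\<J> K" ?A lebesgue, OF finite_reps[OF K] A] sum_overlap_le[OF K \<tau> \<theta>] U
    by (simp add: mult.assoc)
  have "measure lebesgue (sublevel K \<tau> \<theta>) \<le> (\<Sum>J\<in>\<J> K. measure lebesgue (?A J))"
    unfolding U by (intro measure_UNION_le finite_reps[OF K] fmeasurableD A)
  also have "\<dots> \<le> C_bar nrm fd \<psi> \<J> K * (\<tau> ^ (DIM('a) - K) * (\<theta> + ?d * \<tau>) ^ K)"
    unfolding C_bar_def sum_distrib_right by (intro sum_mono bounds)
  finally show ?upper by (simp add: mult.assoc)
qed

text \<open>Nested sublevel sets subtract exactly, so the lower bound at \<open>K\<close> is
  combined with the upper bound at \<open>K - 1\<close>, and conversely. The \<open>C_bar\<close>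
  terms of index \<open>K - 1\<close> in \<open>eps0'\<close> and \<open>eps1\<close> are these
  subtracted bounds, divided by \<open>\<theta> ^ N\<close>.\<close>

lemma measure_DK:
  assumes K: "K \<le> DIM('a)" and \<tau>: "0 < \<tau>"
    and \<theta>: "\<tau> * max (Delta \<psi> \<J> \<delta>J \<delta>JJ K) (Delta_pred \<psi> \<J> \<delta>J \<delta>JJ K) \<le> \<theta>"
  shows "C_bar nrm fd \<psi> \<J> K * \<tau> ^ (DIM('a) - K) * (\<theta> - delta_hat \<J> \<delta>J K * \<tau>) ^ K
           - \<theta> ^ DIM('a) * eps0' nrm fd \<delta>\<^sub>2 \<psi> \<J> \<delta>J \<delta>JJ K \<tau> \<theta>
         \<le> measure lebesgue (DK nrm I \<psi> K \<tau> \<inter> lev fd \<theta>)" (is ?lower)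
    and "measure lebesgue (DK nrm I \<psi> K \<tau> \<inter> lev fd \<theta>)
         \<le> C_bar nrm fd \<psi> \<J> K * \<tau> ^ (DIM('a) - K) * (\<theta> + delta_hat \<J> \<delta>J K * \<tau>) ^ K
           + \<theta> ^ DIM('a) * eps1 nrm fd \<delta>\<^sub>2 \<psi> \<J> \<delta>J \<delta>JJ K \<tau> \<theta>" (is ?upper)
proof -
  have "\<tau> * Delta \<psi> \<J> \<delta>J \<delta>JJ K \<le> \<tau> * max (Delta \<psi> \<J> \<delta>J \<delta>JJ K) (Delta_pred \<psi> \<J> \<delta>J \<delta>JJ K)"
    using \<tau> by (intro mult_left_mono) auto
  then have \<theta>K: "\<tau> * Delta \<psi> \<J> \<delta>J \<delta>JJ K \<le> \<theta>" using \<theta> by linarith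
  \<comment> \<open>Positivity at level 0 propagates upwards by monotonicity of
    \<open>Delta\<close>, so \<open>\<theta>\<close> is positive and division by it is
    legitimate.\<close>
  have "0 < \<tau> * Delta \<psi> \<J> \<delta>J \<delta>JJ K"
    using \<tau> Delta_0_pos Delta_mono[of 0 K] by (intro mult_pos_pos) auto
  then have \<theta>0: "0 < \<theta>" using \<theta>K by linarith
  note K_bounds = measure_sublevel[OF K \<tau> \<theta>0 \<theta>K]
  have "?lower \<and> ?upper"
  proof (cases K)
    \<comment> \<open>There is no smaller sublevel set to subtract, in accordance with the
      conventions for index -1.\<close>
    case 0
    have "DK nrm I \<psi> K \<tau> \<inter> lev fd \<theta> = sublevel K \<tau> \<theta>"
      by (simp add: DK_def sublevel_def 0)
    then show ?thesis using K_bounds by (simp add: eps0'_def eps1_def 0 eps0_def)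
  next
    case (Suc M)
    have M: "M \<le> DIM('a)" using K Suc by simp
    have "\<tau> * Delta \<psi> \<J> \<delta>J \<delta>JJ M \<le> \<tau> * Delta \<psi> \<J> \<delta>J \<delta>JJ K"
      using \<tau> Delta_mono[of M K] Suc by (intro mult_left_mono) auto
    then have \<theta>M: "\<tau> * Delta \<psi> \<J> \<delta>J \<delta>JJ M \<le> \<theta>" using \<theta>K by linarith
    note M_bounds = measure_sublevel[OF M \<tau> \<theta>0 \<theta>M]
    have "DK nrm I \<psi> K \<tau> \<inter> lev fd \<theta> = sublevel K \<tau> \<theta> - sublevel M \<tau> \<theta>"
      by (auto simp: DK_def sublevel_def Suc)
    moreover have "sublevel M \<tau> \<theta> \<subseteq> sublevel K \<tau> \<theta>"
      by (auto simp: sublevel_def Suc)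
    ultimately have m: "measure lebesgue (DK nrm I \<psi> K \<tau> \<inter> lev fd \<theta>)
        = measure lebesgue (sublevel K \<tau> \<theta>) - measure lebesgue (sublevel M \<tau> \<theta>)"
      using sublevel_lmeasurable[OF K] sublevel_lmeasurable[OF M] \<tau>
      by (simp add: measurable_measure_Diff fmeasurableD)
    have homogeneous: "\<theta> ^ DIM('a) * (C_bar nrm fd \<psi> \<J> M * (\<tau> / \<theta>) ^ (DIM('a) - M) * (1 + a * (\<tau> / \<theta>)) ^ M)
        = C_bar nrm fd \<psi> \<J> M * \<tau> ^ (DIM('a) - M) * (\<theta> + a * \<tau>) ^ M" for a
      using power_mult_homogeneous[of \<theta> M "DIM('a)" \<tau> a] \<theta>0 M
      by (simp only: mult.assoc mult.left_commute[of "\<theta> ^ DIM('a)"])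
    have eps0': "\<theta> ^ DIM('a) * eps0' nrm fd \<delta>\<^sub>2 \<psi> \<J> \<delta>J \<delta>JJ K \<tau> \<theta>
        = \<theta> ^ DIM('a) * eps0 fd \<delta>\<^sub>2 \<psi> \<J> \<delta>JJ K \<tau> \<theta>
          + C_bar nrm fd \<psi> \<J> M * \<tau> ^ (DIM('a) - M) * (\<theta> + delta_hat \<J> \<delta>J M * \<tau>) ^ M"
      by (simp only: eps0'_def Suc diff_Suc_1 nat.simps if_False distrib_left homogeneous)
    have eps1: "\<theta> ^ DIM('a) * eps1 nrm fd \<delta>\<^sub>2 \<psi> \<J> \<delta>J \<delta>JJ K \<tau> \<theta>
        = \<theta> ^ DIM('a) * eps0 fd \<delta>\<^sub>2 \<psi> \<J> \<delta>JJ M \<tau> \<theta>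
          - C_bar nrm fd \<psi> \<J> M * \<tau> ^ (DIM('a) - M) * (\<theta> - delta_hat \<J> \<delta>J M * \<tau>) ^ M"
      \<comment> \<open>The inner radius is the case of a negative slope \<open>a\<close>.\<close>
      using homogeneous[of "- delta_hat \<J> \<delta>J M"]
      by (simp only: eps1_def Suc diff_Suc_1 nat.simps if_False right_diff_distrib
          mult_minus_left add_uminus_conv_diff)
    show ?thesis using K_bounds M_bounds unfolding m eps0' eps1 by linarith
  qed
  then show ?lower ?upper by auto
qed

end

theorem theorem3:
  fixes nrm fd :: "real ^ 'n \<Rightarrow> real"
    and I :: "'i set" and \<psi> :: "'i \<Rightarrow> real ^ 'n"
    and \<delta>\<^sub>1 \<delta>\<^sub>2 \<tau> \<theta> :: real
    and \<delta>J :: "'i set \<Rightarrow> real" and \<delta>JJ :: "'i set \<Rightarrow> 'i set \<Rightarrow> real"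
    and \<J> :: "nat \<Rightarrow> 'i set set"
    and K :: nat
  assumes "is_norm nrm" and "is_norm fd"
    and "finite I" and "span (\<psi> ` I) = UNIV"
    and "0 < \<delta>\<^sub>1" and "0 < \<delta>\<^sub>2"
    and "\<And>w. fd w \<le> \<delta>\<^sub>1 * norm w"
    and "\<And>w. norm w \<le> \<delta>\<^sub>2 * nrm w"
    and "\<And>J. J \<subseteq> I \<Longrightarrow> 0 \<le> \<delta>J J \<and> \<delta>J J \<le> \<delta>\<^sub>1 * \<delta>\<^sub>2"
    and "\<And>J u. J \<subseteq> I \<Longrightarrow> u \<in> (TJ \<psi> J)\<^sup>\<bottom> \<Longrightarrow> fd u \<le> \<delta>J J * hJ nrm \<psi> J u"
    and "\<And>L. L \<le> CARD('n) \<Longrightarrow> span_representatives I \<psi> L (\<J> L)"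
    and "\<J> 0 = {{}}"
    and "\<And>L k J1 J2. L \<le> CARD('n) \<Longrightarrow> k < L \<Longrightarrow> (J1, J2) \<in> HKk \<psi> \<J> L k \<Longrightarrow>
           0 \<le> \<delta>JJ J1 J2 \<and> \<delta>JJ J1 J2 \<le> 3 * (\<delta>\<^sub>1 * \<delta>\<^sub>2)"
    and "\<And>L k J1 J2 t r. L \<le> CARD('n) \<Longrightarrow> k < L \<Longrightarrow> (J1, J2) \<in> HKk \<psi> \<J> L k \<Longrightarrow>
           0 < t \<Longrightarrow> 0 < r \<Longrightarrow> \<delta>JJ J1 J2 * t \<le> r \<Longrightarrow>
           measure lebesgue (TJtau nrm \<psi> J1 t \<inter> TJtau nrm \<psi> J2 t \<inter> lev fd r)
             \<le> QJJ fd \<delta>\<^sub>2 \<psi> J1 J2 * t ^ (CARD('n) - k) * (r + \<delta>JJ J1 J2 * t) ^ k"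
    and "K \<le> CARD('n)"
    and "0 < \<tau>"
    and "\<theta> \<ge> \<tau> * max (Delta \<psi> \<J> \<delta>J \<delta>JJ K) (Delta_pred \<psi> \<J> \<delta>J \<delta>JJ K)"
  shows "C_bar nrm fd \<psi> \<J> K * \<tau> ^ (CARD('n) - K) * (\<theta> - delta_hat \<J> \<delta>J K * \<tau>) ^ K
           - \<theta> ^ CARD('n) * eps0' nrm fd \<delta>\<^sub>2 \<psi> \<J> \<delta>J \<delta>JJ K \<tau> \<theta>
         \<le> measure lebesgue (DK nrm I \<psi> K \<tau> \<inter> lev fd \<theta>)
       \<and> measure lebesgue (DK nrm I \<psi> K \<tau> \<inter> lev fd \<theta>)
         \<le> C_bar nrm fd \<psi> \<J> K * \<tau> ^ (CARD('n) - K) * (\<theta> + delta_hat \<J> \<delta>J K * \<tau>) ^ K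
           + \<theta> ^ CARD('n) * eps1 nrm fd \<delta>\<^sub>2 \<psi> \<J> \<delta>J \<delta>JJ K \<tau> \<theta>"
proof -
  have \<delta>J: "0 \<le> \<delta>J J" if "J \<subseteq> I" for J
    using assms(9)[OF that] by (rule conjunct1)
  have \<delta>JJ: "0 \<le> \<delta>JJ J1 J2" if "L \<le> CARD('n)" "k < L" "(J1, J2) \<in> HKk \<psi> \<J> L k" for L k J1 J2
    using assms(13)[OF that] by (rule conjunct1)
  \<comment> \<open>For \<open>real ^ 'n\<close> the quantity \<open>DIM\<close> unfolds to
    \<open>CARD('n)\<close>, after which the locale assumptions are literally the available
    facts.\<close>
  interpret dictionary_measure nrm fd I \<psi> \<delta>\<^sub>2 \<delta>J \<delta>JJ \<J>
    by (rule dictionary_measure.intro, unfold DIM_cart DIM_real mult_1_right)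
       (fact assms \<delta>J \<delta>JJ)+
  show ?thesis
    using measure_DK[of K \<tau> \<theta>] assms(15-17) by (simp only: DIM_cart DIM_real mult_1_right simp_thms)
qed

end
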